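(* Let $\epsilon > 0$ and let $v_1, \dots, v_m$ be independent random vectors in $\mathbb{C}^d$ with finite support such that $$\sum_{i=1}^m \mathbb{E}\left[v_i v_i^{*}\right] = I_d \quad\text{and}\quad \mathbb{E}\left[\|v_i\|^{2}\right] \le \epsilon \ \text{ for all } i\in\{1,\dots,m\}.$$ Then $$\mathbb{P}\left[\, \left\|\sum_{i=1}^m v_i v_i^{*}\right\| \le (1 + \sqrt{\epsilon})^2 \right] > 0.$$
   Context: Here $v^*$ is the conjugate transpose of the column vector $v$, $I_d$ is the $d\times d$ identity matrix, $\|v\|$ is the Euclidean norm for vectors, and $\|M\|$ is the operator (spectral) norm for matrices. A random vector has finite support if it takes only finitely many values. *)

theory Defs
  imports "HOL-Probability.Probability"
begin

text \<open>
  The rank-one matrix \<open>v v\<^sup>*\<close>, where \<open>v\<^sup>*\<close> is the conjugate transpose of the column vector \<open>v\<close>.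
\<close>
definition outer_self :: "complex ^ 'd \<Rightarrow> complex ^ 'd ^ 'd" where
  "outer_self v = (\<chi> i j. v $ i * cnj (v $ j))"

text \<open>
  The operator norm with respect to the Euclidean norm.  The library's \<open>norm\<close> on the matrix type
  is the Frobenius norm instead.
\<close>
definition op_norm :: "complex ^ 'd ^ 'd \<Rightarrow> real" where
  "op_norm A = onorm (\<lambda>x. A *v x)"

definition has_finite_support :: "'w measure \<Rightarrow> ('w \<Rightarrow> 'b) \<Rightarrow> bool" where
  "has_finite_support M X \<longleftrightarrow> finite (X ` space M)"

end

theory Submission
  imports Defs "HOL-Computational_Algebra.Fundamental_Theorem_Algebra"
begin

text \<open>
  The proof follows Marcus, Spielman and Srivastava, with directional derivatives replaced by
  differences.  Let \<open>F X\<close> be the expectation of \<open>det (X - \<Sum> v\<^sub>i v\<^sub>i\<^sup>*)\<close> over some of the vectors.  Such an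
  \<open>F\<close> is affine along rank-one directions and has no zero \<open>X\<close> whose imaginary part is positive
  definite.  Hence for Hermitian \<open>X\<close> and positive definite \<open>A\<close>, the rational function
  \<open>t \<mapsto> 1 - F (X + t A - u u\<^sup>*) / F (X + t A)\<close> maps the upper half-plane to the closed lower one, and so
  equals \<open>\<Sum> r\<^sub>y / (t - y)\<close> with \<open>r\<^sub>y \<ge> 0\<close> and real \<open>y\<close>: the ratio \<open>F (X - u u\<^sup>*) / F X\<close> is increasing and
  concave along positive semidefinite directions above the roots of \<open>F\<close>.  Monotonicity replaces
  interlacing: if \<open>X\<close> is above the roots of the average of \<open>F (X - w w\<^sup>*)\<close> over the values \<open>w\<close> of one
  vector, then some \<open>X - w w\<^sup>*\<close> is above the roots of \<open>F\<close>.  Concavity gives the barrier argument, which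
  puts \<open>(1 + sqrt \<epsilon>)\<^sup>2 I\<close> above the roots of the full expectation.
\<close>

section \<open>Hermitian forms and determinants\<close>

text \<open>Complex factors let the parameter of a matrix line run through the upper half-plane; for
  real factors this is \<open>*\<^sub>R\<close>.\<close>

definition cscale :: "complex \<Rightarrow> complex ^ 'n ^ 'n \<Rightarrow> complex ^ 'n ^ 'n" where
  "cscale z A = (\<chi> i j. z * A $ i $ j)"

definition adj :: "complex ^ 'n ^ 'n \<Rightarrow> complex ^ 'n ^ 'n" where
  "adj X = (\<chi> i j. cnj (X $ j $ i))"

definition hform :: "complex ^ 'n ^ 'n \<Rightarrow> complex ^ 'n \<Rightarrow> complex" where
  "hform X x = (\<Sum>i\<in>UNIV. \<Sum>j\<in>UNIV. cnj (x $ i) * X $ i $ j * x $ j)"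

definition psd :: "complex ^ 'n ^ 'n \<Rightarrow> bool" where
  "psd A \<longleftrightarrow> adj A = A \<and> (\<forall>x. 0 \<le> Re (hform A x))"

definition pd :: "complex ^ 'n ^ 'n \<Rightarrow> bool" where
  "pd A \<longleftrightarrow> adj A = A \<and> (\<forall>x. x \<noteq> 0 \<longrightarrow> 0 < Re (hform A x))"

text \<open>The matrix upper half-plane: the imaginary part of \<open>hform X x\<close> is the form
  of the Hermitian matrix (X - adj X) / (2i), which is thus positive definite.\<close>

definition upper :: "complex ^ 'n ^ 'n \<Rightarrow> bool" where
  "upper X \<longleftrightarrow> (\<forall>x. x \<noteq> 0 \<longrightarrow> 0 < Im (hform X x))"

lemma hform_add: "hform (X + Y) x = hform X x + hform Y x"
  by (simp add: hform_def algebra_simps sum.distrib)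

lemma hform_diff: "hform (X - Y) x = hform X x - hform Y x"
  by (simp add: hform_def algebra_simps sum_subtractf)

lemma hform_cscale: "hform (cscale z X) x = z * hform X x"
  by (simp add: hform_def cscale_def algebra_simps sum_distrib_left)

lemma hform_0 [simp]: "hform 0 x = 0" by (simp add: hform_def)

lemma hform_outer_self:
  "hform (outer_self u) x = of_real ((cmod (\<Sum>i\<in>UNIV. cnj (u $ i) * x $ i))\<^sup>2)"
proof -
  have "hform (outer_self u) x = cnj (\<Sum>i\<in>UNIV. cnj (u $ i) * x $ i) * (\<Sum>i\<in>UNIV. cnj (u $ i) * x $ i)"
    unfolding hform_def outer_self_def cnj_sum sum_product by (simp add: mult_ac)
  then show ?thesis by (metis complex_norm_square mult.commute)
qed

lemma hform_mat_1: "hform (mat 1) x = of_real ((norm x)\<^sup>2)"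
proof -
  have "hform (mat 1) x = (\<Sum>i\<in>UNIV. cnj (x $ i) * x $ i)"
    unfolding hform_def mat_def by (simp add: if_distrib if_distribR cong: if_cong)
  also have "\<dots> = (\<Sum>i\<in>UNIV. of_real ((cmod (x $ i))\<^sup>2))"
    by (intro sum.cong refl) (metis complex_norm_square mult.commute)
  also have "\<dots> = of_real ((norm x)\<^sup>2)"
    by (simp add: norm_vec_def L2_set_def sum_nonneg)
  finally show ?thesis .
qed

lemma hform_mult_vec: "hform X x = (\<Sum>i\<in>UNIV. cnj (x $ i) * (X *v x) $ i)"
  by (simp add: hform_def matrix_vector_mult_def sum_distrib_left mult_ac)

lemma hform_adj: "hform (adj X) x = cnj (hform X x)"
  unfolding hform_def adj_def cnj_sum by (subst sum.swap) (simp add: mult_ac)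

lemma hform_hermitian: "adj X = X \<Longrightarrow> Im (hform X x) = 0"
  by (metis complex_cnj_cancel_iff hform_adj Reals_cnj_iff complex_is_Real_iff)

lemma adj_add: "adj (X + Y) = adj X + adj Y"
  and adj_diff: "adj (X - Y) = adj X - adj Y"
  and adj_cscale: "adj (cscale z X) = cscale (cnj z) (adj X)"
  and adj_outer_self [simp]: "adj (outer_self u) = outer_self u"
  and adj_mat_1 [simp]: "adj (mat 1) = mat 1"
  and adj_0 [simp]: "adj 0 = 0"
  and adj_scaleR: "adj (r *\<^sub>R X) = r *\<^sub>R adj X"
  by (auto simp: adj_def cscale_def outer_self_def mat_def vec_eq_iff)

lemma cscale_of_real: "cscale (of_real r) X = r *\<^sub>R X"
  by (simp add: cscale_def vec_eq_iff scaleR_conv_of_real[where 'a=complex])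

lemma hform_scaleR: "hform (r *\<^sub>R X) x = of_real r * hform X x"
  by (metis cscale_of_real hform_cscale)

lemma cscale_simps [simp]: "cscale 0 X = 0" "cscale (-1) X = - X"
  by (simp_all add: cscale_def vec_eq_iff)

lemma psd_0 [simp]: "psd 0"
  and psd_add: "psd A \<Longrightarrow> psd B \<Longrightarrow> psd (A + B)"
  and psd_scaleR: "0 \<le> r \<Longrightarrow> psd A \<Longrightarrow> psd (r *\<^sub>R A)"
  and psd_outer_self [simp]: "psd (outer_self u)"
  and psd_mat_1 [simp]: "psd (mat 1)"
  by (auto simp: psd_def adj_add adj_scaleR hform_add hform_scaleR hform_outer_self hform_mat_1)

lemma psd_sum: "(\<And>k. k \<in> S \<Longrightarrow> psd (f k)) \<Longrightarrow> psd (\<Sum>k\<in>S. f k)"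
  by (induction S rule: infinite_finite_induct) (auto simp: psd_add)

lemma pd_mat_1 [simp]: "pd (mat 1)"
  by (auto simp: pd_def hform_mat_1)

lemma pd_scaleR: "0 < r \<Longrightarrow> pd A \<Longrightarrow> pd (r *\<^sub>R A)"
  by (auto simp: pd_def adj_scaleR hform_scaleR)

lemma pd_add_psd: "pd A \<Longrightarrow> psd B \<Longrightarrow> pd (A + B)"
  by (auto simp: pd_def psd_def adj_add hform_add add_pos_nonneg)

lemma psd_if_pd: "pd A \<Longrightarrow> psd A"
proof -
  have "Re (hform A 0) = 0" by (simp add: hform_def)
  then show "pd A \<Longrightarrow> psd A"
    unfolding pd_def psd_def by (metis order.strict_implies_order order_refl)
qed

section \<open>Determinants: nonvanishing, rank-one updates and lines\<close>

lemma det_nonzero_if_upper: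
  assumes "upper X" shows "det X \<noteq> 0"
proof
  assume "det X = 0"
  then have "\<not> invertible X" by (simp add: invertible_det_nz)
  then obtain x where "X *v x = 0" "x \<noteq> 0"
    using invertible_left_inverse matrix_left_invertible_ker by blast
  then have "hform X x = 0" by (simp add: hform_mult_vec)
  with assms \<open>x \<noteq> 0\<close> show False unfolding upper_def by fastforce
qed

lemma det_nonzero_if_pd:
  assumes "pd A" shows "det A \<noteq> 0"
proof
  assume "det A = 0"
  then have "\<not> invertible A" by (simp add: invertible_det_nz)
  then obtain x where "A *v x = 0" "x \<noteq> 0"
    using invertible_left_inverse matrix_left_invertible_ker by blast
  then have "hform A x = 0" by (simp add: hform_mult_vec)
  with assms \<open>x \<noteq> 0\<close> show False unfolding pd_def by fastforce
qed

lemma continuous_on_det: "continuous_on UNIV (det :: complex ^ 'n ^ 'n \<Rightarrow> complex)"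
  unfolding det_def by (intro continuous_intros)

lemma det_adj: "det (adj X) = cnj (det X)"
proof -
  have "adj X = transpose (\<chi> i j. cnj (X $ i $ j))"
    by (simp add: adj_def transpose_def)
  then have "det (adj X) = det (\<chi> i j. cnj (X $ i $ j))"
    by (metis det_transpose)
  also have "\<dots> = cnj (det X)" by (simp add: det_def)
  finally show ?thesis .
qed

text \<open>A shear sends \<open>u\<close> to a multiple of a basis vector, so that only one row depends on \<open>z\<close>.\<close>
lemma det_rank_one_affine:
  fixes X :: "'a::field ^ 'n ^ 'n"
  shows "\<exists>a b. \<forall>z. det (X + (\<chi> i j. z * (u $ i * v $ j))) = a + z * b"
proof (cases "u = 0")
  case True
  then have "X + (\<chi> i j. z * (u $ i * v $ j)) = X" for z by (simp add: vec_eq_iff)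
  then show ?thesis by (intro exI[of _ "det X"] exI[of _ 0]) simp
next
  case False
  then obtain k where k: "u $ k \<noteq> 0" by (auto simp: vec_eq_iff)
  define Q :: "'a ^ 'n ^ 'n" where
    "Q = (\<chi> i j. (if i = j then 1 else 0) + (if j = k then (if i \<noteq> k then - u $ i / u $ k else 0) else 0))"
  have Q: "(Q *v x) $ i = x $ i + (if i \<noteq> k then - u $ i / u $ k * x $ k else 0)" for x i
    unfolding Q_def matrix_vector_mult_def
    by (simp add: distrib_right sum.distrib if_distrib[of "\<lambda>c. c * _"] cong: if_cong)
  have ker: "\<forall>x. Q *v x = 0 \<longrightarrow> x = 0"
  proof (intro allI impI)
    fix x assume "Q *v x = 0"
    have *: "x $ i + (if i \<noteq> k then - u $ i / u $ k * x $ k else 0) = 0" for i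
      using Q[of x i] \<open>Q *v x = 0\<close> by simp
    have "x $ k = 0" using *[of k] by simp
    then have "x $ i = 0" for i using *[of i] by (auto split: if_splits)
    then show "x = 0" by (simp add: vec_eq_iff)
  qed
  have "invertible Q"
    unfolding invertible_left_inverse matrix_left_invertible_ker by (fact ker)
  then have dQ: "det Q \<noteq> 0" by (simp add: invertible_det_nz)
  have QM: "(Q ** M) $ i $ j = M $ i $ j + (if i \<noteq> k then - u $ i / u $ k * M $ k $ j else 0)" for M i j
    unfolding Q_def matrix_matrix_mult_def
    by (simp add: distrib_right sum.distrib if_distrib[of "\<lambda>c. c * _"] cong: if_cong)
  \<comment> \<open>After the shear only row \<open>k\<close> depends on \<open>z\<close>, and
    affinely, so linearity of the determinant in that row finishes.\<close>
  have eq: "Q ** (X + (\<chi> i j. z * (u $ i * v $ j))) =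
    (\<chi> i. if i = k then (Q ** X) $ i + (z * u $ k) *s v else (Q ** X) $ i)" for z
    using k by (simp add: vec_eq_iff QM field_simps)
  have "det Q * det (X + (\<chi> i j. z * (u $ i * v $ j))) =
     det (\<chi> i. if i = k then (Q ** X) $ i else (Q ** X) $ i) +
     (z * u $ k) * det (\<chi> i. if i = k then v else (Q ** X) $ i)" for z
    unfolding det_mul[symmetric] eq
    by (subst det_row_add) (subst det_row_mul, simp)
  then have "det (X + (\<chi> i j. z * (u $ i * v $ j))) =
     det (\<chi> i. if i = k then (Q ** X) $ i else (Q ** X) $ i) / det Q +
     z * (u $ k * det (\<chi> i. if i = k then v else (Q ** X) $ i) / det Q)" for z
    using dQ by (simp add: field_simps)
  then show ?thesis by blast
qed

text \<open>An affine function of \<open>z\<close> is determined by its values at 0 and -1; this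
  makes the slope a difference of two determinants.\<close>

lemma det_outer_self:
  "det (X + cscale z (outer_self u)) = det X + z * (det X - det (X - outer_self u))"
proof -
  obtain a b where ab: "\<And>z. det (X + (\<chi> i j. z * (u $ i * (\<chi> j. cnj (u $ j)) $ j))) = a + z * b"
    using det_rank_one_affine by blast
  have eq: "(\<chi> i j. z * (u $ i * (\<chi> j. cnj (u $ j)) $ j)) = cscale z (outer_self u)" for z
    by (simp add: cscale_def outer_self_def)
  have *: "det (X + cscale z (outer_self u)) = a + z * b" for z
    using ab[of z] unfolding eq .
  have "det X = a" "det X - det (X - outer_self u) = b" using *[of 0] *[of "-1"] by simp_all
  then show ?thesis using *[of z] by simp
qed

lemma poly_det: "poly (det M) t = det (\<chi> i j. poly (M $ i $ j) t)"
  for M :: "'a::comm_ring_1 poly ^ 'n ^ 'n"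
  by (simp add: det_def poly_sum poly_prod)

lemma degree_coeff_prod_linear:
  fixes a b :: "'i \<Rightarrow> 'a::comm_ring_1"
  assumes "finite S"
  shows "degree (\<Prod>i\<in>S. [:a i, b i:]) \<le> card S \<and> coeff (\<Prod>i\<in>S. [:a i, b i:]) (card S) = (\<Prod>i\<in>S. b i)"
  using assms
proof (induction S)
  case (insert k S)
  have "degree ([:a k, b k:] * (\<Prod>i\<in>S. [:a i, b i:])) \<le> degree [:a k, b k:] + degree (\<Prod>i\<in>S. [:a i, b i:])"
    by (rule degree_mult_le)
  also have "\<dots> \<le> Suc (card S)" using insert.IH by (simp add: degree_pCons_eq_if)
  finally show ?case using insert by (simp add: coeff_eq_0)
qed simp

text \<open>The coefficient of degree \<open>CARD('n)\<close> does not depend on \<open>X\<close>.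
  Hence it cancels in the difference of two parallel lines, and it is nonzero for positive definite
  \<open>A\<close>.\<close>

lemma det_line:
  fixes X A :: "complex ^ 'n ^ 'n"
  shows "\<exists>p. degree p \<le> CARD('n) \<and> coeff p CARD('n) = det A \<and> (\<forall>t. det (X + cscale t A) = poly p t)"
proof (intro exI conjI allI)
  let ?M = "(\<chi> i j. [:X $ i $ j, A $ i $ j:]) :: complex poly ^ 'n ^ 'n"
  have deg: "degree (of_int c * (\<Prod>i\<in>UNIV. [:X $ i $ p i, A $ i $ p i:])) \<le> CARD('n)" for p and c :: int
    using degree_coeff_prod_linear[of "UNIV :: 'n set" "\<lambda>i. X $ i $ p i" "\<lambda>i. A $ i $ p i"]
    by (intro order_trans[OF degree_mult_le]) simp
  show "degree (det ?M) \<le> CARD('n)"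
    unfolding det_def by (intro degree_sum_le) (auto simp: deg finite_permutations)
  have "coeff (of_int c * (\<Prod>i\<in>UNIV. [:X $ i $ p i, A $ i $ p i:])) CARD('n) =
        of_int c * (\<Prod>i\<in>UNIV. A $ i $ p i)" for p and c :: int
    using degree_coeff_prod_linear[of "UNIV :: 'n set" "\<lambda>i. X $ i $ p i" "\<lambda>i. A $ i $ p i"]
    by (simp add: of_int_poly)
  then show "coeff (det ?M) CARD('n) = det A"
    unfolding det_def by (simp add: coeff_sum)
  show "det (X + cscale t A) = poly (det ?M) t" for t
    unfolding poly_det by (intro arg_cong[where f = det]) (simp add: vec_eq_iff cscale_def)
qed

section \<open>Partial fractions of Pick functions\<close>

text \<open>Near \<open>y\<close>, on the ray of angle \<theta>, the quotient f / h behaves like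
  \<rho>^k \<open>cis (k * \<theta>)\<close> g(y) / h(y). Dividing by the positive \<rho>^k keeps
  the sign of the imaginary part, and the limit inherits it.\<close>

lemma Im_cis_power_limit:
  fixes f h :: "complex poly" and y :: real
  assumes pick: "\<And>t. 0 < Im t \<Longrightarrow> poly h t \<noteq> 0 \<Longrightarrow> 0 \<le> Im (poly f t / poly h t)"
    and f: "f = [:- of_real y, 1:] ^ k * g" and h: "poly h (of_real y) \<noteq> 0"
    and \<theta>: "0 < \<theta>" "\<theta> < pi"
  shows "0 \<le> Im (poly g (of_real y) / poly h (of_real y) * cis (k * \<theta>))"
proof -
  have mult_of_real_Im: "Im (of_real c * z) = c * Im z" for c z by simp
  define t where "t = (\<lambda>\<rho>::real. of_real y + of_real \<rho> * cis \<theta>)"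
  have t: "(t \<longlongrightarrow> of_real y) (at_right 0)"
    unfolding t_def by (auto intro!: tendsto_eq_intros)
  have lim: "((\<lambda>\<rho>. Im (poly g (t \<rho>) / poly h (t \<rho>) * cis (k * \<theta>))) \<longlongrightarrow>
      Im (poly g (of_real y) / poly h (of_real y) * cis (k * \<theta>))) (at_right 0)"
    by (intro tendsto_intros t h isCont_tendsto_compose[OF _ t] poly_isCont)
  have "\<forall>\<^sub>F \<rho> in at_right 0. poly h (t \<rho>) \<noteq> 0"
    by (rule tendsto_imp_eventually_ne[OF isCont_tendsto_compose[OF poly_isCont t] h])
  moreover have "\<forall>\<^sub>F \<rho>::real in at_right 0. 0 < \<rho>"
    by (simp add: eventually_at_right_less)
  ultimately have "\<forall>\<^sub>F \<rho> in at_right 0. 0 \<le> Im (poly g (t \<rho>) / poly h (t \<rho>) * cis (k * \<theta>))"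
  proof eventually_elim
    case (elim \<rho>)
    have "0 < sin \<theta>" using \<theta> by (rule sin_gt_zero)
    then have "0 < Im (t \<rho>)" using elim by (simp add: t_def)
    with pick elim have "0 \<le> Im (poly f (t \<rho>) / poly h (t \<rho>))" by blast
    also have "poly f (t \<rho>) = of_real (\<rho> ^ k) * (cis (k * \<theta>) * poly g (t \<rho>))"
      using Complex.DeMoivre[of \<theta> k] unfolding f by (simp add: t_def power_mult_distrib)
    also have "\<dots> / poly h (t \<rho>) = of_real (\<rho> ^ k) * (poly g (t \<rho>) / poly h (t \<rho>) * cis (k * \<theta>))"
      by simp
    finally have "0 \<le> \<rho> ^ k * Im (poly g (t \<rho>) / poly h (t \<rho>) * cis (k * \<theta>))"
      unfolding mult_of_real_Im .
    then show ?case using zero_less_power[OF elim(2), of k] by (simp only: zero_le_mult_iff) linarith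
  qed
  with lim show ?thesis by (rule tendsto_lowerbound) simp
qed

text \<open>A root of order k turns the half-circle of directions above \<open>y\<close> into an
  angle of k pi. A nonzero number cannot keep a nonnegative imaginary part through a full turn, so k
  = 1; the half turn then forces the residue to be nonnegative.\<close>

lemma Pick_ratio_simple_root:
  fixes f h :: "complex poly" and y :: real
  assumes pick: "\<And>t. 0 < Im t \<Longrightarrow> poly h t \<noteq> 0 \<Longrightarrow> 0 \<le> Im (poly f t / poly h t)"
    and f0: "f \<noteq> 0" and root: "poly f (of_real y) = 0" and h: "poly h (of_real y) \<noteq> 0"
  shows "poly (pderiv f) (of_real y) \<noteq> 0 \<and> poly h (of_real y) / poly (pderiv f) (of_real y) \<in> \<real>\<^sub>\<ge>\<^sub>0"
proof -
  define k where "k = order (of_real y) f"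
  obtain g where g: "f = [:- of_real y, 1:] ^ k * g" "\<not> [:- of_real y, 1:] dvd g"
    using order_decomp[OF f0, of "of_real y"] unfolding k_def by blast
  define a where "a = poly g (of_real y) / poly h (of_real y)"
  have g0: "poly g (of_real y) \<noteq> 0" using g(2) by (simp add: poly_eq_0_iff_dvd)
  then have a: "a \<noteq> 0" using h by (simp add: a_def)
  have k1: "1 \<le> k" using root f0 unfolding k_def by (metis One_nat_def Suc_leI neq0_conv order_root)
  have pos: "0 \<le> Im (a * cis (k * \<theta>))" if "0 < \<theta>" "\<theta> < pi" for \<theta> :: real
    unfolding a_def by (rule Im_cis_power_limit[OF pick g(1) h that])
  have lim: "((\<lambda>\<theta>. Im (a * cis (k * \<theta>))) \<longlongrightarrow> Im (a * cis (k * \<theta>))) (at \<theta> within S)" for \<theta> :: real and S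
    by (intro tendsto_intros)
  have pos': "0 \<le> Im (a * cis (k * \<theta>))" if "0 \<le> \<theta>" "\<theta> \<le> pi" for \<theta> :: real
  proof -
    from that consider "\<theta> = 0" | "\<theta> = pi" | "0 < \<theta>" "\<theta> < pi" by linarith
    then show ?thesis
    proof cases
      case 1
      have "\<forall>\<^sub>F \<theta>::real in at_right 0. 0 \<le> Im (a * cis (k * \<theta>))"
        using eventually_at_right_real[OF pi_gt_zero] by eventually_elim (use pos in auto)
      from tendsto_lowerbound[OF lim this] show ?thesis by (simp add: 1)
    next
      case 2
      have "\<forall>\<^sub>F \<theta> in at_left pi. 0 \<le> Im (a * cis (k * \<theta>))"
        using eventually_at_left_real[OF pi_gt_zero] by eventually_elim (use pos in auto)
      from tendsto_lowerbound[OF lim this] show ?thesis by (simp add: 2)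
    qed (use pos in auto)
  qed
  have "k = 1"
  proof (rule ccontr)
    assume "k \<noteq> 1"
    with k1 have k2: "2 \<le> real k" by linarith
    have full: "0 \<le> Im (a * cis \<psi>)" if "0 \<le> \<psi>" "\<psi> \<le> 2 * pi" for \<psi>
    proof -
      have "\<psi> / k \<le> pi"
        using that k2 mult_left_mono[OF k2 pi_ge_zero] by (subst pos_divide_le_eq) linarith+
      then show ?thesis using pos'[of "\<psi> / k"] that k2 by simp
    qed
    have "cis (3 / 2 * pi) = - \<i>"
      by (rule complex_eqI) (simp_all only: cis.sel cos_3over2_pi sin_3over2_pi, simp_all)
    \<comment> \<open>The four quarter turns make Im a, Re a, -Im a and -Re a nonnegative, so a =
      0.\<close>
    then show False
      using full[of 0] full[of "pi / 2"] full[of pi] full[of "3 / 2 * pi"] a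
      by (simp add: complex_eq_iff)
  qed
  then have *: "f = [:- of_real y, 1:] * g" using g by simp
  have d: "poly (pderiv f) (of_real y) = poly g (of_real y)"
    unfolding * by (simp add: pderiv_mult pderiv_pCons del: mult_pCons_left)
  have "Im a = 0" "0 \<le> Re a"
    using pos'[of 0] pos'[of pi] pos'[of "pi / 2"] \<open>k = 1\<close> by (auto simp: cis.code)
  then have "a \<in> \<real>\<^sub>\<ge>\<^sub>0" by (simp add: complex_nonneg_Reals_iff)
  then have "inverse a \<in> \<real>\<^sub>\<ge>\<^sub>0" by (rule nonneg_Reals_inverse_I)
  then show ?thesis unfolding d using g0 by (simp add: a_def)
qed

text \<open>Lagrange interpolation at the simple roots of \<open>f\<close> recovers
  \<open>h\<close>, whose degree is below their number; dividing by \<open>f\<close> turns the basis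
  polynomials into simple fractions.\<close>

lemma lagrange_partial_fraction:
  fixes f h :: "complex poly"
  assumes sqf: "rsquarefree f" and deg: "degree h < degree f" and t: "poly f t \<noteq> 0"
  shows "poly h t / poly f t = (\<Sum>y | poly f y = 0. poly h y / poly (pderiv f) y / (t - y))"
proof -
  define S where "S = {y. poly f y = 0}"
  define c where "c = lead_coeff f"
  have f0: "f \<noteq> 0" using t by auto
  then have c: "c \<noteq> 0" by (simp add: c_def)
  have fin: "finite S" unfolding S_def using f0 by (rule poly_roots_finite)
  have f: "f = smult c (\<Prod>z\<in>S. [:-z, 1:])"
    using complex_poly_decompose_rsquarefree[OF sqf] by (simp add: c_def S_def)
  have deg_prod: "degree (\<Prod>z\<in>T. [:-z, 1:]) = card T" if "finite T" for T :: "complex set"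
    using that by (subst degree_prod_eq_sum_degree) auto
  have cardS: "card S = degree f" using c deg_prod[OF fin] by (subst f) simp
  have pd: "poly (pderiv f) y = c * (\<Prod>z\<in>S - {y}. y - z)" if "y \<in> S" for y
  proof -
    have "f = [:-y, 1:] * smult c (\<Prod>z\<in>S - {y}. [:-z, 1:])"
      by (subst f) (simp add: prod.remove[OF fin that])
    then have "pderiv f = smult c (\<Prod>z\<in>S - {y}. [:-z, 1:]) +
        [:-y, 1:] * pderiv (smult c (\<Prod>z\<in>S - {y}. [:-z, 1:]))"
      by (metis (no_types, lifting) add.commute mult_1 mult.commute pderiv_mult pderiv_pCons pderiv_1 
          one_pCons pderiv_singleton add_0 pCons_0_0)
    then show ?thesis by (simp add: poly_prod)
  qed
  \<comment> \<open>The Lagrange basis polynomial at \<open>y\<close>, scaled to take the value h(y)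
    there: by \<open>pd\<close>, the derivative of \<open>f\<close> at \<open>y\<close> is
    \<open>c\<close> times the product of the y - z.\<close>
  define P where "P = (\<lambda>y. smult (poly h y / poly (pderiv f) y * c) (\<Prod>z\<in>S - {y}. [:-z, 1:]))"
  have P: "poly (P y) x = poly h y / poly (pderiv f) y * (c * (\<Prod>z\<in>S - {y}. x - z))" for x y
    by (simp add: P_def poly_prod)
  have nz: "poly (pderiv f) y \<noteq> 0" if "y \<in> S" for y
    using sqf that by (simp add: rsquarefree_roots S_def)
  have "h = (\<Sum>y\<in>S. P y)"
  proof (rule poly_eqI_degree)
    fix x assume x: "x \<in> S"
    have "poly (P y) x = 0" if "y \<in> S - {x}" for y
      using that x fin unfolding P by (auto intro!: prod_zero)
    then have "poly (\<Sum>y\<in>S. P y) x = poly (P x) x"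
      using x fin by (simp add: poly_sum sum.remove)
    also have "\<dots> = poly h x" using pd[OF x] nz[OF x] by (simp add: P)
    finally show "poly h x = poly (\<Sum>y\<in>S. P y) x" ..
  next
    show "degree h < card S" using deg cardS by simp
    have "degree (P y) \<le> card S - 1" if "y \<in> S" for y
      unfolding P_def using fin that deg_prod[of "S - {y}"]
      by (intro order_trans[OF degree_smult_le]) simp
    then have "degree (\<Sum>y\<in>S. P y) \<le> card S - 1"
      by (intro degree_sum_le fin)
    then show "degree (\<Sum>y\<in>S. P y) < card S" using deg cardS by linarith
  qed
  then have "poly h t = (\<Sum>y\<in>S. poly (P y) t)" by (metis poly_sum)
  also have "\<dots> = (\<Sum>y\<in>S. poly h y / poly (pderiv f) y / (t - y) * poly f t)"
  proof (rule sum.cong[OF refl])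
    fix y assume y: "y \<in> S"
    have "poly f t = c * ((t - y) * (\<Prod>z\<in>S - {y}. t - z))"
      by (subst f) (simp add: poly_prod prod.remove[OF fin y] left_diff_distrib)
    moreover have "t \<noteq> y" using t y by (auto simp: S_def)
    ultimately show "poly (P y) t = poly h y / poly (pderiv f) y / (t - y) * poly f t"
      by (simp add: P)
  qed
  finally have "poly h t = (\<Sum>y\<in>S. poly h y / poly (pderiv f) y / (t - y)) * poly f t"
    by (simp only: sum_distrib_right)
  then show ?thesis using t by (simp add: S_def)
qed

text \<open>Common roots cancel; at the others the sign condition forces simple poles with nonnegative residues.\<close>
lemma Pick_partial_fractions:
  fixes f h :: "complex poly"
  assumes f0: "f \<noteq> 0" and real: "\<And>t. poly f t = 0 \<Longrightarrow> Im t = 0"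
    and deg: "h = 0 \<or> degree h < degree f"
    and pick: "\<And>t. 0 < Im t \<Longrightarrow> Im (poly h t / poly f t) \<le> 0"
  shows "\<exists>S r. finite S \<and> (\<forall>y\<in>S. poly f (of_real y) = 0 \<and> 0 \<le> r y) \<and>
    (\<forall>t. poly f t \<noteq> 0 \<longrightarrow> poly h t / poly f t = (\<Sum>y\<in>S. of_real (r y) / (t - of_real y)))"
  using assms
proof (induction "degree f" arbitrary: f h rule: less_induct)
  case less
  show ?case
  proof (cases "h = 0 \<or> (\<exists>y. poly f y = 0 \<and> poly h y = 0)")
    case True
    show ?thesis
    proof (cases "h = 0")
      case True
      then show ?thesis by (intro exI[of _ "{}"]) auto
    next
      case False
      with \<open>h = 0 \<or> (\<exists>y. poly f y = 0 \<and> poly h y = 0)\<close>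
      obtain y where y: "poly f y = 0" "poly h y = 0" by blast
      then obtain f1 h1 where fh: "f = [:-y, 1:] * f1" "h = [:-y, 1:] * h1"
        by (meson dvdE poly_eq_0_iff_dvd)
      have nz: "f1 \<noteq> 0" "h1 \<noteq> 0" using less.prems(1) False fh by auto
      have degs: "degree f = Suc (degree f1)" "degree h = Suc (degree h1)"
        unfolding fh using nz degree_mult_eq[of "[:-y, 1:]"] by auto
      have "Im y = 0" using less.prems(2) y by blast
      have pk: "Im (poly h1 t / poly f1 t) \<le> 0" if "0 < Im t" for t
      proof -
        have "t \<noteq> y" using that \<open>Im y = 0\<close> by auto
        moreover have "poly f t = (t - y) * poly f1 t" "poly h t = (t - y) * poly h1 t"
          by (simp_all add: fh algebra_simps)
        ultimately have "poly h t / poly f t = poly h1 t / poly f1 t" by simp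
        then show ?thesis using less.prems(4)[OF that] by simp
      qed
      obtain S r where Sr: "finite S" "\<forall>y\<in>S. poly f1 (of_real y) = 0 \<and> 0 \<le> r y"
        "\<forall>t. poly f1 t \<noteq> 0 \<longrightarrow> poly h1 t / poly f1 t = (\<Sum>y\<in>S. of_real (r y) / (t - of_real y))"
        using less.hyps[of f1 h1] nz degs less.prems(2,3) pk fh by auto
      show ?thesis
      proof (intro exI conjI ballI allI impI)
        fix t assume "poly f t \<noteq> 0"
        moreover have "poly f t = (t - y) * poly f1 t" "poly h t = (t - y) * poly h1 t"
          by (simp_all add: fh algebra_simps)
        ultimately have "poly h t / poly f t = poly h1 t / poly f1 t" "poly f1 t \<noteq> 0"
          by auto
        then show "poly h t / poly f t = (\<Sum>y\<in>S. of_real (r y) / (t - of_real y))"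
          using Sr(3) by simp
      qed (use Sr in \<open>auto simp: fh\<close>)
    qed
  next
    case False
    \<comment> \<open>Inversion swaps the half-planes; at zeros of \<open>h\<close> the quotient is
      0 by convention and the bound still holds.\<close>
    have inv: "0 \<le> Im (poly f t / poly h t)" if "0 < Im t" for t
    proof -
      define w where "w = poly f t / poly h t"
      have "Im (inverse w) \<le> 0" using less.prems(4)[OF that] by (simp add: w_def)
      moreover have "Im (inverse w) = - Im w / (cmod w)\<^sup>2" by (simp add: cmod_power2)
      ultimately have "0 \<le> Im w" by (cases "w = 0") (auto simp: zero_le_divide_iff)
      then show ?thesis by (simp add: w_def)
    qed
    have res: "poly (pderiv f) y \<noteq> 0 \<and> poly h y / poly (pderiv f) y \<in> \<real>\<^sub>\<ge>\<^sub>0" if "poly f y = 0" for y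
    proof -
      have y: "y = of_real (Re y)" using less.prems(2)[OF that] by (simp add: complex_eq_iff)
      show ?thesis
        using Pick_ratio_simple_root[of h f "Re y"] inv less.prems(1) that False
        unfolding y[symmetric] by blast
    qed
    then have sqf: "rsquarefree f" by (auto simp: rsquarefree_roots)
    have deg: "degree h < degree f" using less.prems(3) False by auto
    define r where "r = (\<lambda>y. Re (poly h (of_real y) / poly (pderiv f) (of_real y)))"
    have fin: "finite {y. poly f y = 0}" using less.prems(1) by (rule poly_roots_finite)
    show ?thesis
    proof (intro exI[of _ "Re ` {y. poly f y = 0}"] exI[of _ r] conjI ballI allI impI)
      show "finite (Re ` {y. poly f y = 0})" using fin by simp
    next
      fix y assume "y \<in> Re ` {y. poly f y = 0}"
      then obtain z where z: "poly f z = 0" "y = Re z" by auto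
      then have zy: "z = of_real y" using less.prems(2) by (simp add: complex_eq_iff)
      then show "poly f (of_real y) = 0" using z by simp
      show "0 \<le> r y" using res[OF z(1)] unfolding zy r_def by (simp add: complex_nonneg_Reals_iff)
    next
      fix t assume t: "poly f t \<noteq> 0"
      have inj: "inj_on Re {y. poly f y = 0}"
        using less.prems(2) by (auto simp: inj_on_def complex_eq_iff)
      have *: "of_real (r (Re y)) / (t - of_real (Re y)) = poly h y / poly (pderiv f) y / (t - y)"
        if "poly f y = 0" for y
      proof -
        have y: "of_real (Re y) = y" using less.prems(2)[OF that] by (simp add: complex_eq_iff)
        have "of_real (r (Re y)) = poly h y / poly (pderiv f) y"
          using res[OF that] unfolding r_def y
          by (simp add: complex_nonneg_Reals_iff complex_eq_iff)
        then show ?thesis unfolding y by simp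
      qed
      show "poly h t / poly f t = (\<Sum>y\<in>Re ` {y. poly f y = 0}. of_real (r y) / (t - of_real y))"
        using * by (subst sum.reindex[OF inj])
          (simp add: lagrange_partial_fraction[OF sqf deg t])
    qed
  qed
qed

section \<open>Stable forms\<close>

text \<open>
  By the third clause, \<open>F X - F (X - u u\<^sup>*)\<close> is the derivative of \<open>F\<close> at \<open>X\<close> in direction \<open>u u\<^sup>*\<close>.
\<close>
definition stable_form :: "(complex ^ 'n ^ 'n \<Rightarrow> complex) \<Rightarrow> bool" where
  "stable_form F \<longleftrightarrow>
    continuous_on UNIV F \<and>
    (\<forall>X. F (adj X) = cnj (F X)) \<and>
    (\<forall>X u z. F (X + cscale z (outer_self u)) = F X + z * (F X - F (X - outer_self u))) \<and>
    (\<forall>X A. \<exists>p. degree p \<le> CARD('n) \<and> coeff p CARD('n) = det A \<and> (\<forall>t. F (X + cscale t A) = poly p t)) \<and>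
    (\<forall>X. upper X \<longrightarrow> F X \<noteq> 0)"

lemma stable_form_det: "stable_form det"
  unfolding stable_form_def
  using continuous_on_det det_adj det_outer_self det_line det_nonzero_if_upper by blast

lemma upper_add_outer_self:
  assumes "upper X" "0 \<le> Im z" shows "upper (X + cscale z (outer_self u))"
  using assms unfolding upper_def hform_add hform_cscale hform_outer_self
  by (auto intro!: add_pos_nonneg)

text \<open>\<open>F\<close> is affine along the rank-one direction and vanishes there at z = -1/w,
  where w is the quotient on the right. If w were nonzero with Im w nonnegative, then Im z would be
  nonnegative too, and the zero would be at an \<open>upper\<close> matrix.\<close>

lemma stable_form_ratio:
  assumes F: "stable_form F" and X: "upper X"
  shows "F X = F (X - outer_self u) \<or> Im ((F X - F (X - outer_self u)) / F X) < 0"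
proof (rule disjCI)
  assume neg: "\<not> Im ((F X - F (X - outer_self u)) / F X) < 0"
  define h where "h = F X - F (X - outer_self u)"
  have FX: "F X \<noteq> 0" using F X by (auto simp: stable_form_def)
  show "F X = F (X - outer_self u)"
  proof (rule ccontr)
    assume "F X \<noteq> F (X - outer_self u)"
    then have h: "h \<noteq> 0" by (simp add: h_def)
    define w where "w = h / F X"
    have w: "w \<noteq> 0" "0 \<le> Im w" using neg h FX by (auto simp: w_def h_def)
    have "Im (- inverse w) = Im w / (cmod w)\<^sup>2" by (simp add: cmod_power2)
    then have "0 \<le> Im (- inverse w)" using w by simp
    then have "upper (X + cscale (- inverse w) (outer_self u))"
      by (rule upper_add_outer_self[OF X])
    then have "F (X + cscale (- inverse w) (outer_self u)) \<noteq> 0"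
      using F by (auto simp: stable_form_def)
    moreover have "F (X + cscale (- inverse w) (outer_self u)) = F X + (- inverse w) * h"
      using F unfolding stable_form_def h_def by blast
    ultimately show False using h FX by (simp add: w_def)
  qed
qed

text \<open>All clauses but the last pass to the average by linearity, the top coefficient because
  the weights sum to 1. For the last, dividing by \<open>F X\<close> leaves 1 -
  \<open>sum h W\<close>, where each \<open>h w\<close> is zero or has negative imaginary part, so
  the sum is never 1.\<close>

lemma stable_form_average:
  fixes F :: "complex ^ 'n ^ 'n \<Rightarrow> complex"
  assumes F: "stable_form F" and W: "finite W" and p: "\<And>w. w \<in> W \<Longrightarrow> 0 \<le> p w" "sum p W = 1"
  shows "stable_form (\<lambda>X. \<Sum>w\<in>W. of_real (p w) * F (X - outer_self w))"
  unfolding stable_form_def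
proof (intro conjI allI impI)
  have "continuous_on UNIV F" using F by (simp add: stable_form_def)
  then show "continuous_on UNIV (\<lambda>X. \<Sum>w\<in>W. of_real (p w) * F (X - outer_self w))"
    by (auto intro!: continuous_intros elim!: continuous_on_compose2)
next
  fix X :: "complex ^ 'n ^ 'n"
  have "F (adj X - outer_self w) = cnj (F (X - outer_self w))" for w
    using F unfolding stable_form_def by (metis adj_diff adj_outer_self)
  then show "(\<Sum>w\<in>W. of_real (p w) * F (adj X - outer_self w)) =
      cnj (\<Sum>w\<in>W. of_real (p w) * F (X - outer_self w))" by simp
next
  fix X :: "complex ^ 'n ^ 'n" and u z
  have affine: "F (X + cscale z (outer_self u) - outer_self w) = F (X - outer_self w) +
      z * (F (X - outer_self w) - F (X - outer_self u - outer_self w))" for w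
  proof -
    have "F (X - outer_self w + cscale z (outer_self u)) = F (X - outer_self w) +
      z * (F (X - outer_self w) - F (X - outer_self w - outer_self u))"
      using F unfolding stable_form_def by blast
    then show ?thesis by (simp add: algebra_simps)
  qed
  show "(\<Sum>w\<in>W. of_real (p w) * F (X + cscale z (outer_self u) - outer_self w)) =
      (\<Sum>w\<in>W. of_real (p w) * F (X - outer_self w)) +
      z * ((\<Sum>w\<in>W. of_real (p w) * F (X - outer_self w)) -
           (\<Sum>w\<in>W. of_real (p w) * F (X - outer_self u - outer_self w)))"
    unfolding affine sum_distrib_left right_diff_distrib distrib_left sum.distrib sum_subtractf
    by (simp add: mult_ac)
next
  fix X A :: "complex ^ 'n ^ 'n"
  have "\<forall>w. \<exists>q. degree q \<le> CARD('n) \<and> coeff q CARD('n) = det A \<and>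
      (\<forall>t. F (X - outer_self w + cscale t A) = poly q t)"
    using F unfolding stable_form_def by blast
  then obtain q where q: "\<And>w. degree (q w) \<le> CARD('n)" "\<And>w. coeff (q w) CARD('n) = det A"
    "\<And>w t. F (X - outer_self w + cscale t A) = poly (q w) t" by metis
  show "\<exists>q. degree q \<le> CARD('n) \<and> coeff q CARD('n) = det A \<and>
      (\<forall>t. (\<Sum>w\<in>W. of_real (p w) * F (X + cscale t A - outer_self w)) = poly q t)"
  proof (intro exI conjI allI)
    show "degree (\<Sum>w\<in>W. smult (of_real (p w)) (q w)) \<le> CARD('n)"
      by (intro degree_sum_le W order_trans[OF degree_smult_le] q)
    have "coeff (\<Sum>w\<in>W. smult (of_real (p w)) (q w)) CARD('n) = of_real (sum p W) * det A"
      by (simp add: coeff_sum q sum_distrib_right)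
    then show "coeff (\<Sum>w\<in>W. smult (of_real (p w)) (q w)) CARD('n) = det A" by (simp add: p)
    show "(\<Sum>w\<in>W. of_real (p w) * F (X + cscale t A - outer_self w)) =
        poly (\<Sum>w\<in>W. smult (of_real (p w)) (q w)) t" for t
      by (simp add: poly_sum q(3)[symmetric] algebra_simps)
  qed
next
  fix X :: "complex ^ 'n ^ 'n" assume X: "upper X"
  have FX: "F X \<noteq> 0" using F X by (simp add: stable_form_def)
  have mult_of_real_Im: "Im (of_real c * z) = c * Im z" for c z by simp
  define h where "h = (\<lambda>w. of_real (p w) * ((F X - F (X - outer_self w)) / F X))"
  have G: "(\<Sum>w\<in>W. of_real (p w) * F (X - outer_self w)) = F X * (1 - sum h W)"
  proof -
    have "F X * (1 - sum h W) = F X * (of_real (sum p W) - sum h W)" by (simp add: p)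
    also have "\<dots> = (\<Sum>w\<in>W. F X * of_real (p w) - F X * h w)"
      by (simp add: sum_distrib_left algebra_simps sum_subtractf)
    also have "\<dots> = (\<Sum>w\<in>W. of_real (p w) * F (X - outer_self w))"
      using FX by (intro sum.cong) (auto simp: h_def field_simps)
    finally show ?thesis ..
  qed
  have h: "h w = 0 \<or> Im (h w) < 0" if "w \<in> W" for w
  proof -
    have "Im (h w) = p w * Im ((F X - F (X - outer_self w)) / F X)"
      unfolding h_def by (simp only: mult_of_real_Im)
    then show ?thesis
      using stable_form_ratio[OF F X, of w] p(1)[OF that]
      by (cases "p w = 0") (auto simp: mult_less_0_iff h_def)
  qed
  have "sum h W \<noteq> 1"
  proof (cases "\<forall>w\<in>W. h w = 0")
    case False
    then obtain w where "w \<in> W" "h w \<noteq> 0" by blast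
    then have "(\<Sum>w\<in>W. Im (h w)) < (\<Sum>w\<in>W. 0)"
      using W h by (intro sum_strict_mono_ex1) (auto, fastforce)
    then show ?thesis by (auto simp flip: Im_sum)
  qed simp
  then show "(\<Sum>w\<in>W. of_real (p w) * F (X - outer_self w)) \<noteq> 0"
    using G FX by simp
qed

lemma stable_form_real:
  assumes "stable_form F" "adj X = X" shows "F X = of_real (Re (F X))"
  using assms unfolding stable_form_def by (metis Reals_cnj_iff of_real_Re)

text \<open>A stable form is real at Hermitian matrices (\<open>stable_form_real\<close>), so taking
  real parts loses nothing there.\<close>

definition ratio :: "(complex ^ 'n ^ 'n \<Rightarrow> complex) \<Rightarrow> complex ^ 'n \<Rightarrow> complex ^ 'n ^ 'n \<Rightarrow> real" where
  "ratio F u X = Re (F (X - outer_self u)) / Re (F X)"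

lemma upper_line:
  assumes "adj X = X" "pd A" "0 < Im t" shows "upper (X + cscale t A)"
  using assms hform_hermitian[of X] hform_hermitian[of A]
  unfolding upper_def pd_def hform_add hform_cscale by auto

text \<open>Applies \<open>Pick_partial_fractions\<close> to \<open>f\<close> and
  \<open>f - g\<close>, where \<open>f\<close> and \<open>g\<close> are the polynomials of
  \<open>F\<close> on the lines through \<open>X\<close> and \<open>X - outer_self u\<close>;
  \<open>stable_form_ratio\<close> supplies the sign condition.\<close>

lemma ratio_line_partial_fractions:
  fixes F :: "complex ^ 'n ^ 'n \<Rightarrow> complex"
  assumes F: "stable_form F" and X: "adj X = X" and A: "pd A"
  shows "\<exists>S r. finite S \<and> (\<forall>y\<in>S. Re (F (X + y *\<^sub>R A)) = 0 \<and> 0 \<le> r y) \<and>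
    (\<forall>t. Re (F (X + t *\<^sub>R A)) \<noteq> 0 \<longrightarrow> ratio F u (X + t *\<^sub>R A) = 1 - (\<Sum>y\<in>S. r y / (t - y)))"
proof -
  have adjA: "adj A = A" using A by (simp add: pd_def)
  obtain f where f: "degree f \<le> CARD('n)" "coeff f CARD('n) = det A"
    "\<And>t. F (X + cscale t A) = poly f t"
    using F unfolding stable_form_def by metis
  obtain g where g: "degree g \<le> CARD('n)" "coeff g CARD('n) = det A"
    "\<And>t. F (X - outer_self u + cscale t A) = poly g t"
    using F unfolding stable_form_def by metis
  have dA: "det A \<noteq> 0" using A by (rule det_nonzero_if_pd)
  have degf: "degree f = CARD('n)" using f dA le_degree[of f "CARD('n)"] by simp
  have f0: "f \<noteq> 0" using f dA by auto
  \<comment> \<open>Roots come in conjugate pairs, and for a nonreal root one of \<open>t\<close>,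
    \<open>cnj t\<close> would lie in the open upper half-plane, where the line consists of
    \<open>upper\<close> matrices.\<close>
  have f_real: "Im t = 0" if "poly f t = 0" for t
  proof (rule ccontr)
    have "poly f (cnj t) = cnj (poly f t)"
      using F X adjA unfolding stable_form_def f(3)[symmetric] by (metis adj_add adj_cscale)
    then have *: "poly f (cnj t) = 0" using that by simp
    assume "Im t \<noteq> 0"
    then consider "0 < Im t" | "0 < Im (cnj t)" by fastforce
    then show False
    proof cases
      case 1
      show False using F upper_line[OF X A 1] that by (auto simp: stable_form_def f(3))
    next
      case 2
      show False using F upper_line[OF X A 2] * by (auto simp: stable_form_def f(3))
    qed
  qed
  \<comment> \<open>Both top coefficients are \<open>det A\<close>, so the difference has smaller
    degree.\<close>
  have "degree (f - g) \<le> CARD('n)" using f g by (intro degree_diff_le)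
  moreover have "coeff (f - g) CARD('n) = 0" using f g by simp
  ultimately have deg: "f - g = 0 \<or> degree (f - g) < degree f"
    unfolding degf using eq_zero_or_degree_less by blast
  have pick: "Im (poly (f - g) t / poly f t) \<le> 0" if "0 < Im t" for t
  proof -
    have eq: "X + cscale t A - outer_self u = X - outer_self u + cscale t A" by simp
    show ?thesis
      using stable_form_ratio[OF F upper_line[OF X A that], of u]
      unfolding eq f(3) g(3) by (auto simp del: Im_divide)
  qed
  obtain S r where Sr: "finite S" "\<forall>y\<in>S. poly f (of_real y) = 0 \<and> 0 \<le> r y"
    "\<forall>t. poly f t \<noteq> 0 \<longrightarrow> poly (f - g) t / poly f t = (\<Sum>y\<in>S. of_real (r y) / (t - of_real y))"
    using Pick_partial_fractions[OF f0 f_real deg pick] by blast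
  have Ff: "F (X + t *\<^sub>R A) = poly f (of_real t)" for t
    using f(3)[of "of_real t"] by (simp add: cscale_of_real)
  have Fg: "F (X + t *\<^sub>R A - outer_self u) = poly g (of_real t)" for t
    using g(3)[of "of_real t"] by (simp add: cscale_of_real algebra_simps)
  have adjt: "adj (X + t *\<^sub>R A) = X + t *\<^sub>R A" "adj (X + t *\<^sub>R A - outer_self u) = X + t *\<^sub>R A - outer_self u" for t
    using X adjA by (simp_all add: adj_add adj_diff adj_scaleR)
  show ?thesis
  proof (intro exI conjI ballI allI impI)
    fix t assume nz: "Re (F (X + t *\<^sub>R A)) \<noteq> 0"
    then have "poly f (of_real t) \<noteq> 0" unfolding Ff by auto
    with Sr(3) have "poly (f - g) (of_real t) / poly f (of_real t) = of_real (\<Sum>y\<in>S. r y / (t - y))"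
      by simp
    moreover have "poly f (of_real t) = of_real (Re (F (X + t *\<^sub>R A)))"
      using stable_form_real[OF F adjt(1)] by (simp add: Ff)
    moreover have "poly g (of_real t) = of_real (Re (F (X + t *\<^sub>R A - outer_self u)))"
      using stable_form_real[OF F adjt(2)] by (simp add: Fg)
    ultimately have "of_real ((Re (F (X + t *\<^sub>R A)) - Re (F (X + t *\<^sub>R A - outer_self u))) / Re (F (X + t *\<^sub>R A)))
        = (of_real (\<Sum>y\<in>S. r y / (t - y)) :: complex)"
      by simp
    then have "(Re (F (X + t *\<^sub>R A)) - Re (F (X + t *\<^sub>R A - outer_self u))) / Re (F (X + t *\<^sub>R A)) = (\<Sum>y\<in>S. r y / (t - y))"
      by (simp only: of_real_eq_iff)
    then show "ratio F u (X + t *\<^sub>R A) = 1 - (\<Sum>y\<in>S. r y / (t - y))"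
      using nz by (simp add: ratio_def diff_divide_distrib)
  qed (use Sr in \<open>auto simp: Ff\<close>)
qed

section \<open>The region above the roots\<close>

text \<open>The matrix analogue of lying to the right of the largest root. Positivity is demanded in
  all positive semidefinite directions at once, so that the region is closed under adding such
  matrices (\<open>above_add\<close>).\<close>

definition above_roots :: "(complex ^ 'n ^ 'n \<Rightarrow> complex) \<Rightarrow> complex ^ 'n ^ 'n \<Rightarrow> bool" where
  "above_roots F X \<longleftrightarrow> adj X = X \<and> (\<forall>P. psd P \<longrightarrow> 0 < Re (F (X + P)))"

lemma above_pos: "above_roots F X \<Longrightarrow> 0 < Re (F X)"
  unfolding above_roots_def using psd_0 by fastforce

lemma above_add: "above_roots F X \<Longrightarrow> psd P \<Longrightarrow> above_roots F (X + P)"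
  unfolding above_roots_def by (metis add.assoc adj_add psd_add psd_def)

text \<open>All poles on the line are negative, so for t \<ge> 0 each term -r / (t - y) is
  increasing and concave. Concavity compares the chord slopes on [0, \<delta>] and
  [\<delta>, \<delta> + \<tau>], with denominators cleared.\<close>

lemma ratio_pd_mono_concave:
  fixes F :: "complex ^ 'n ^ 'n \<Rightarrow> complex"
  assumes F: "stable_form F" and X: "above_roots F X" and A: "pd A" and ge: "0 \<le> \<delta>" "0 \<le> \<tau>"
  shows "ratio F u X \<le> ratio F u (X + \<delta> *\<^sub>R A)"
    and "\<delta> * (ratio F u (X + (\<delta> + \<tau>) *\<^sub>R A) - ratio F u (X + \<delta> *\<^sub>R A)) \<le>
         \<tau> * (ratio F u (X + \<delta> *\<^sub>R A) - ratio F u X)"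
proof -
  have adjX: "adj X = X" using X by (simp add: above_roots_def)
  obtain S r where Sr: "finite S" "\<And>y. y \<in> S \<Longrightarrow> Re (F (X + y *\<^sub>R A)) = 0" "\<And>y. y \<in> S \<Longrightarrow> 0 \<le> r y"
    and R: "\<And>t. Re (F (X + t *\<^sub>R A)) \<noteq> 0 \<Longrightarrow> ratio F u (X + t *\<^sub>R A) = 1 - (\<Sum>y\<in>S. r y / (t - y))"
    using ratio_line_partial_fractions[OF F adjX A, of u] by blast
  have pos: "0 < Re (F (X + t *\<^sub>R A))" if "0 \<le> t" for t
    using above_pos[OF above_add[OF X psd_scaleR[OF that psd_if_pd[OF A]]]] .
  have neg: "y < 0" if "y \<in> S" for y
    using pos[of y] Sr(2)[OF that] by (cases "0 \<le> y") auto
  have R': "ratio F u (X + t *\<^sub>R A) = 1 - (\<Sum>y\<in>S. r y / (t - y))" if "0 \<le> t" for t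
    using R pos[OF that] by simp
  have R0: "ratio F u X = 1 - (\<Sum>y\<in>S. r y / (0 - y))" using R'[of 0] by simp
  have "r y / (\<delta> - y) \<le> r y / (0 - y)" if "y \<in> S" for y
    using neg[OF that] Sr(3)[OF that] ge by (intro divide_left_mono) (auto intro!: mult_pos_neg)
  then show "ratio F u X \<le> ratio F u (X + \<delta> *\<^sub>R A)"
    unfolding R0 R'[OF ge(1)] using sum_mono[of S "\<lambda>y. r y / (\<delta> - y)" "\<lambda>y. r y / (0 - y)"] by simp
  have "\<delta> * (r y / (\<delta> - y) - r y / (\<delta> + \<tau> - y)) \<le> \<tau> * (r y / (0 - y) - r y / (\<delta> - y))"
    if y: "y \<in> S" for y
  proof -
    define a where "a = - y"
    have a: "0 < a" using neg[OF y] by (simp add: a_def)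
    have "\<delta> * (1 / (a + \<delta>) - 1 / (a + \<delta> + \<tau>)) = \<delta> * \<tau> / ((a + \<delta>) * (a + \<delta> + \<tau>))"
      using a ge by (simp add: divide_simps)
    also have "\<dots> \<le> \<delta> * \<tau> / (a * (a + \<delta>))"
      using a ge by (intro divide_left_mono) (auto intro!: mult_pos_pos add_pos_nonneg mult_mono simp: mult.commute[of a])
    also have "\<dots> = \<tau> * (1 / a - 1 / (a + \<delta>))"
      using a ge by (simp add: divide_simps)
    finally have "r y * (\<delta> * (1 / (a + \<delta>) - 1 / (a + \<delta> + \<tau>))) \<le> r y * (\<tau> * (1 / a - 1 / (a + \<delta>)))"
      using Sr(3)[OF y] by (rule mult_left_mono)
    then show ?thesis by (simp add: a_def algebra_simps)
  qed
  then have "(\<Sum>y\<in>S. \<delta> * (r y / (\<delta> - y) - r y / (\<delta> + \<tau> - y))) \<le> (\<Sum>y\<in>S. \<tau> * (r y / (0 - y) - r y / (\<delta> - y)))"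
    by (rule sum_mono)
  then show "\<delta> * (ratio F u (X + (\<delta> + \<tau>) *\<^sub>R A) - ratio F u (X + \<delta> *\<^sub>R A)) \<le>
      \<tau> * (ratio F u (X + \<delta> *\<^sub>R A) - ratio F u X)"
    unfolding R0 R'[OF ge(1)] R'[OF add_nonneg_nonneg[OF ge]]
    by (simp add: sum_subtractf flip: sum_distrib_left)
qed

lemma stable_form_tendsto:
  assumes "stable_form F" "(g \<longlongrightarrow> X) L" shows "((\<lambda>t. F (g t)) \<longlongrightarrow> F X) L"
  using assms continuous_on_tendsto_compose[of UNIV F g X L] unfolding stable_form_def by simp

lemma ratio_tendsto:
  assumes "stable_form F" "(g \<longlongrightarrow> X) L" "Re (F X) \<noteq> 0"
  shows "((\<lambda>t. ratio F u (g t)) \<longlongrightarrow> ratio F u X) L"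
  unfolding ratio_def using assms by (intro tendsto_intros stable_form_tendsto) auto

text \<open>Adding a small positive multiple of \<open>mat 1\<close> makes \<open>A\<close> positive
  definite. Both inequalities survive the limit because \<open>F\<close> is positive at the limit
  points, where \<open>ratio\<close> is therefore continuous.\<close>

lemma ratio_psd_mono_concave:
  fixes F :: "complex ^ 'n ^ 'n \<Rightarrow> complex"
  assumes F: "stable_form F" and X: "above_roots F X" and A: "psd A" and ge: "0 \<le> \<delta>" "0 \<le> \<tau>"
  shows "ratio F u X \<le> ratio F u (X + \<delta> *\<^sub>R A)"
    and "\<delta> * (ratio F u (X + (\<delta> + \<tau>) *\<^sub>R A) - ratio F u (X + \<delta> *\<^sub>R A)) \<le>
         \<tau> * (ratio F u (X + \<delta> *\<^sub>R A) - ratio F u X)"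
proof -
  define B where "B = (\<lambda>\<eta>::real. A + \<eta> *\<^sub>R mat 1)"
  have "\<forall>\<^sub>F \<eta>::real in at_right 0. 0 < \<eta>" by (simp add: eventually_at_right_less)
  then have B: "\<forall>\<^sub>F \<eta> in at_right 0. pd (B \<eta>)"
    by eventually_elim (metis A B_def add.commute pd_add_psd pd_mat_1 pd_scaleR)
  have lim: "((\<lambda>\<eta>. ratio F u (X + t *\<^sub>R B \<eta>)) \<longlongrightarrow> ratio F u (X + t *\<^sub>R A)) (at_right 0)" if "0 \<le> t" for t
  proof (rule ratio_tendsto[OF F])
    show "((\<lambda>\<eta>. X + t *\<^sub>R B \<eta>) \<longlongrightarrow> X + t *\<^sub>R A) (at_right 0)"
      unfolding B_def by (auto intro!: tendsto_eq_intros)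
    show "Re (F (X + t *\<^sub>R A)) \<noteq> 0"
      using above_pos[OF above_add[OF X psd_scaleR[OF that A]]] by simp
  qed
  have "\<forall>\<^sub>F \<eta> in at_right 0. ratio F u X \<le> ratio F u (X + \<delta> *\<^sub>R B \<eta>)"
    using B by eventually_elim (rule ratio_pd_mono_concave(1)[OF F X _ ge])
  with lim[OF ge(1)] show "ratio F u X \<le> ratio F u (X + \<delta> *\<^sub>R A)"
    by (rule tendsto_lowerbound) simp
  have ev: "\<forall>\<^sub>F \<eta> in at_right 0. \<delta> * (ratio F u (X + (\<delta> + \<tau>) *\<^sub>R B \<eta>) - ratio F u (X + \<delta> *\<^sub>R B \<eta>)) \<le>
         \<tau> * (ratio F u (X + \<delta> *\<^sub>R B \<eta>) - ratio F u X)"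
    using B by eventually_elim (rule ratio_pd_mono_concave(2)[OF F X _ ge])
  show "\<delta> * (ratio F u (X + (\<delta> + \<tau>) *\<^sub>R A) - ratio F u (X + \<delta> *\<^sub>R A)) \<le>
         \<tau> * (ratio F u (X + \<delta> *\<^sub>R A) - ratio F u X)"
    by (rule tendsto_le[OF _ _ _ ev]) (auto intro!: tendsto_intros lim ge add_nonneg_nonneg)
qed

text \<open>In the direction of the identity the top coefficient is det I = 1, so the real part is a
  monic real polynomial in \<open>t\<close>.\<close>

lemma stable_form_eventually_pos:
  fixes F :: "complex ^ 'n ^ 'n \<Rightarrow> complex"
  assumes F: "stable_form F"
  shows "\<exists>T. \<forall>t\<ge>T. 0 < Re (F (X + t *\<^sub>R mat 1))"
proof -
  obtain f where f: "degree f \<le> CARD('n)" "coeff f CARD('n) = det (mat 1 :: complex ^ 'n ^ 'n)"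
    "\<And>t. F (X + cscale t (mat 1)) = poly f t"
    using F unfolding stable_form_def by metis
  have Re_poly: "poly (map_poly Re q) t = Re (poly q (of_real t))" for q t
    by (induction q) (auto simp: map_poly_pCons)
  have c1: "coeff (map_poly Re f) CARD('n) = 1" using f(2) by (simp add: coeff_map_poly)
  moreover have "degree (map_poly Re f) \<le> CARD('n)" using f(1) map_poly_degree_leq[of Re f] by linarith
  ultimately have "degree (map_poly Re f) = CARD('n)"
    using le_degree[of "map_poly Re f" "CARD('n)"] by simp
  then have "lead_coeff (map_poly Re f) = 1" using c1 by simp
  then obtain T where "\<forall>x\<ge>T. 1 \<le> poly (map_poly Re f) x"
    using poly_pinfty_gt_lc[of "map_poly Re f"] by auto
  then have "\<forall>x\<ge>T. 0 < poly (map_poly Re f) x" by fastforce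
  moreover have "Re (F (X + t *\<^sub>R mat 1)) = poly (map_poly Re f) t" for t
    using f(3)[of "of_real t"] by (simp add: Re_poly cscale_of_real)
  ultimately show ?thesis by metis
qed

lemma continuous_on_stable_form_line:
  assumes "stable_form F" shows "continuous_on S (\<lambda>t::real. Re (F (X + t *\<^sub>R A)))"
proof -
  have "continuous_on UNIV F" using assms by (simp add: stable_form_def)
  then show ?thesis by (auto intro!: continuous_intros elim!: continuous_on_compose2)
qed

text \<open>If \<open>F\<close> were nonpositive at some X + P, follow the ray in direction
  \<open>mat 1\<close> to its last nonpositive point. Beyond it all poles are passed, so subtracting
  any \<open>outer_self u\<close> does not increase \<open>F\<close>. By continuity all these values
  are at most 0 at the last point itself, so the average is nonpositive at a matrix above X.\<close>

lemma above_if_above_average: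
  fixes F :: "complex ^ 'n ^ 'n \<Rightarrow> complex"
  assumes F: "stable_form F" and W: "finite W" and p: "\<And>w. w \<in> W \<Longrightarrow> 0 \<le> p w" "sum p W = 1"
    and X: "above_roots (\<lambda>X. \<Sum>w\<in>W. of_real (p w) * F (X - outer_self w)) X"
  shows "above_roots F X"
proof -
  have adjX: "adj X = X" using X by (simp add: above_roots_def)
  have "0 < Re (F (X + P))" if P: "psd P" for P
  proof (rule ccontr)
    assume "\<not> 0 < Re (F (X + P))"
    then have le: "Re (F (X + P)) \<le> 0" by simp
    define \<phi> where "\<phi> = (\<lambda>t::real. Re (F (X + P + t *\<^sub>R mat 1)))"
    have cont: "continuous_on S \<phi>" for S
      unfolding \<phi>_def by (rule continuous_on_stable_form_line[OF F])
    obtain T where T: "\<And>t. t \<ge> T \<Longrightarrow> 0 < \<phi> t"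
      using stable_form_eventually_pos[OF F, of "X + P"] unfolding \<phi>_def by blast
    \<comment> \<open>Beyond \<open>max 0 T\<close> all values are positive, so the maximum of the
      compact set \<open>Z\<close> is the last nonpositive point of the whole ray.\<close>
    define Z where "Z = {t \<in> {0..max 0 T}. \<phi> t \<le> 0}"
    have Z: "Z = {0..max 0 T} \<inter> ({0..max 0 T} \<inter> \<phi> -` {..0})" unfolding Z_def by auto
    have "compact Z"
      by (subst Z) (intro compact_Int_closed compact_Icc continuous_closed_preimage cont closed_atLeastAtMost closed_atMost)
    moreover have "0 \<in> Z" using le by (simp add: Z_def \<phi>_def)
    ultimately obtain s where s: "s \<in> Z" "\<And>t. t \<in> Z \<Longrightarrow> t \<le> s"
      using compact_attains_sup[of Z] by blast
    have s0: "0 \<le> s" "\<phi> s \<le> 0" using s by (auto simp: Z_def)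
    have pos: "0 < \<phi> t" if "s < t" for t
    proof (cases "T \<le> t")
      case False
      then have "t \<notin> Z" using s(2)[of t] that by auto
      then show ?thesis using False that s0 by (auto simp: Z_def)
    qed (rule T)
    have adjXP: "adj (X + P) = X + P" using adjX P by (simp add: adj_add psd_def)
    have le': "Re (F (X + P + t *\<^sub>R mat 1 - outer_self u)) \<le> \<phi> t" if t: "s < t" for t u
    proof -
      obtain S r where Sr: "\<forall>y\<in>S. \<phi> y = 0 \<and> 0 \<le> r y"
        and R: "\<forall>t. \<phi> t \<noteq> 0 \<longrightarrow> ratio F u (X + P + t *\<^sub>R mat 1) = 1 - (\<Sum>y\<in>S. r y / (t - y))"
        using ratio_line_partial_fractions[OF F adjXP pd_mat_1, of u] unfolding \<phi>_def by blast
      have S: "y \<le> s" "0 \<le> r y" if "y \<in> S" for y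
        using that Sr pos[of y] by force+
      have "0 \<le> (\<Sum>y\<in>S. r y / (t - y))"
        using S t by (intro sum_nonneg divide_nonneg_nonneg) force+
      then have "ratio F u (X + P + t *\<^sub>R mat 1) \<le> 1"
        using R pos[OF t] by simp
      then show ?thesis using pos[OF t] by (simp add: ratio_def \<phi>_def)
    qed
    have le0: "Re (F (X + P + s *\<^sub>R mat 1 - outer_self u)) \<le> 0" for u
    proof -
      have "((\<lambda>t. Re (F (X + P + t *\<^sub>R mat 1 - outer_self u))) \<longlongrightarrow> Re (F (X + P + s *\<^sub>R mat 1 - outer_self u))) (at_right s)"
        by (intro tendsto_intros stable_form_tendsto[OF F])
      moreover have "(\<phi> \<longlongrightarrow> \<phi> s) (at_right s)"
        unfolding \<phi>_def by (intro tendsto_intros stable_form_tendsto[OF F])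
      moreover have "\<forall>\<^sub>F t in at_right s. Re (F (X + P + t *\<^sub>R mat 1 - outer_self u)) \<le> \<phi> t"
        using le' by (auto simp: eventually_at_filter)
      ultimately have "Re (F (X + P + s *\<^sub>R mat 1 - outer_self u)) \<le> \<phi> s"
        by (intro tendsto_le[of "at_right s"]) auto
      then show ?thesis using s0 by simp
    qed
    have "psd (P + s *\<^sub>R mat 1)" by (intro psd_add P psd_scaleR s0 psd_mat_1)
    then have "0 < Re (\<Sum>w\<in>W. of_real (p w) * F (X + (P + s *\<^sub>R mat 1) - outer_self w))"
      using X by (simp add: above_roots_def)
    also have "\<dots> = (\<Sum>w\<in>W. p w * Re (F (X + P + s *\<^sub>R mat 1 - outer_self w)))"
      by (simp add: add.assoc)
    also have "\<dots> \<le> 0" using p le0 by (intro sum_nonpos mult_nonneg_nonpos) auto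
    finally show False by simp
  qed
  with adjX show ?thesis by (simp add: above_roots_def)
qed

text \<open>A positive average has a positive term of positive weight. Monotonicity of
  \<open>ratio\<close> carries positivity of that term from X to all of X + P.\<close>

lemma above_average_obtain:
  fixes F :: "complex ^ 'n ^ 'n \<Rightarrow> complex"
  assumes F: "stable_form F" and W: "finite W" and p: "\<And>w. w \<in> W \<Longrightarrow> 0 \<le> p w" "sum p W = 1"
    and X: "above_roots (\<lambda>X. \<Sum>w\<in>W. of_real (p w) * F (X - outer_self w)) X"
  obtains w where "w \<in> W" "0 < p w" "above_roots F (X - outer_self w)"
proof -
  have aX: "above_roots F X" by (rule above_if_above_average[OF assms])
  have "0 < Re (\<Sum>w\<in>W. of_real (p w) * F (X - outer_self w))"
    using above_pos[OF X] .
  then have sum_pos: "0 < (\<Sum>w\<in>W. p w * Re (F (X - outer_self w)))" by simp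
  have "\<exists>w\<in>W. 0 < p w * Re (F (X - outer_self w))"
  proof (rule ccontr)
    assume "\<not> ?thesis"
    then have "(\<Sum>w\<in>W. p w * Re (F (X - outer_self w))) \<le> 0" by (intro sum_nonpos) force
    with sum_pos show False by simp
  qed
  then obtain w where w: "w \<in> W" "0 < p w * Re (F (X - outer_self w))" by blast
  then have pw: "0 < p w" "0 < Re (F (X - outer_self w))"
    using p(1)[OF w(1)] by (auto simp: zero_less_mult_iff)
  have "above_roots F (X - outer_self w)"
    unfolding above_roots_def
  proof (intro conjI allI impI)
    show "adj (X - outer_self w) = X - outer_self w" using aX by (simp add: above_roots_def adj_diff)
    fix P :: "complex ^ 'n ^ 'n" assume P: "psd P"
    have "0 < ratio F w X" using pw above_pos[OF aX] by (simp add: ratio_def)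
    also have "\<dots> \<le> ratio F w (X + 1 *\<^sub>R P)"
      by (rule ratio_psd_mono_concave(1)[OF F aX P, of 1 0]) simp_all
    finally have "0 < Re (F (X + P - outer_self w))"
      using above_pos[OF above_add[OF aX P]] by (simp add: ratio_def zero_less_divide_iff)
    then show "0 < Re (F (X - outer_self w + P))" by (simp add: algebra_simps)
  qed
  with w(1) pw(1) show ?thesis by (rule that)
qed

section \<open>The barrier argument\<close>

text \<open>Rank-one directions are added one at a time: by the affine clause a new one contributes
  exactly \<open>t * B t\<close> with \<open>B\<close> continuous at 0, whose derivative there is
  \<open>B 0\<close> by Caratheodory's criterion.\<close>

lemma stable_form_has_real_derivative_0:
  fixes F :: "complex ^ 'n ^ 'n \<Rightarrow> complex"
  assumes F: "stable_form F" and W: "finite W"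
  shows "((\<lambda>t. Re (F (Y + t *\<^sub>R (\<Sum>w\<in>W. p w *\<^sub>R outer_self w)))) has_real_derivative
    (\<Sum>w\<in>W. p w * (Re (F Y) - Re (F (Y - outer_self w))))) (at 0)"
  using W
proof (induction W)
  case (insert k W)
  define A where "A = (\<Sum>w\<in>W. p w *\<^sub>R outer_self w)"
  define B where "B = (\<lambda>t::real. p k * (Re (F (Y + t *\<^sub>R A)) - Re (F (Y + t *\<^sub>R A - outer_self k))))"
  have "F (Y + t *\<^sub>R A + cscale (of_real (t * p k)) (outer_self k)) =
      F (Y + t *\<^sub>R A) + of_real (t * p k) * (F (Y + t *\<^sub>R A) - F (Y + t *\<^sub>R A - outer_self k))" for t
    using F unfolding stable_form_def by blast
  then have "Re (F (Y + t *\<^sub>R A + cscale (of_real (t * p k)) (outer_self k))) = Re (F (Y + t *\<^sub>R A)) + t * B t" for t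
    by (simp add: B_def)
  moreover have "Y + t *\<^sub>R A + cscale (of_real (t * p k)) (outer_self k) =
      Y + t *\<^sub>R (\<Sum>w\<in>insert k W. p w *\<^sub>R outer_self w)" for t
    unfolding cscale_of_real using insert.hyps by (simp add: A_def algebra_simps)
  ultimately have eq: "Re (F (Y + t *\<^sub>R (\<Sum>w\<in>insert k W. p w *\<^sub>R outer_self w))) =
      Re (F (Y + t *\<^sub>R A)) + t * B t" for t by (simp only:)
  have "isCont B 0"
    unfolding B_def isCont_def
    by (intro tendsto_intros stable_form_tendsto[OF F] tendsto_diff) 
  then have "((\<lambda>t. t * B t) has_real_derivative B 0) (at 0)"
    unfolding CARAT_DERIV by (intro exI[of _ B]) (simp add: mult.commute)
  with insert.IH have "((\<lambda>t. Re (F (Y + t *\<^sub>R A)) + t * B t) has_real_derivative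
      (\<Sum>w\<in>W. p w * (Re (F Y) - Re (F (Y - outer_self w)))) + B 0) (at 0)"
    unfolding A_def by (rule DERIV_add)
  then show ?case unfolding eq using insert.hyps by (simp add: B_def add.commute)
qed simp

text \<open>Because the weights sum to 1, the derivative of \<open>F\<close> along the second moment
  \<open>A\<close> is \<open>F\<close> minus its average; so averaging over one random vector is the
  operator 1 - D_A.\<close>

lemma stable_form_has_real_derivative:
  fixes F :: "complex ^ 'n ^ 'n \<Rightarrow> complex"
  assumes F: "stable_form F" and W: "finite W" and p: "sum p W = 1"
    and A: "A = (\<Sum>w\<in>W. p w *\<^sub>R outer_self w)"
  shows "((\<lambda>t. Re (F (X + t *\<^sub>R A))) has_real_derivative
    Re (F (X + s *\<^sub>R A)) - Re (\<Sum>w\<in>W. of_real (p w) * F (X + s *\<^sub>R A - outer_self w))) (at s)"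
proof -
  have "(\<Sum>w\<in>W. p w * (Re (F (X + s *\<^sub>R A)) - Re (F (X + s *\<^sub>R A - outer_self w)))) =
      sum p W * Re (F (X + s *\<^sub>R A)) - Re (\<Sum>w\<in>W. of_real (p w) * F (X + s *\<^sub>R A - outer_self w))"
    by (simp add: right_diff_distrib sum_subtractf sum_distrib_right)
  then have "((\<lambda>t. Re (F (X + s *\<^sub>R A + t *\<^sub>R A))) has_real_derivative
     Re (F (X + s *\<^sub>R A)) - Re (\<Sum>w\<in>W. of_real (p w) * F (X + s *\<^sub>R A - outer_self w))) (at 0)"
    using stable_form_has_real_derivative_0[OF F W, of "X + s *\<^sub>R A" p] p by (simp add: A)
  then show ?thesis
    using DERIV_shift[of "\<lambda>t. Re (F (X + t *\<^sub>R A))" _ 0 s] by (simp add: algebra_simps)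
qed

text \<open>The barrier function of \<open>F\<close> in direction \<open>u u\<^sup>*\<close> is \<open>1 - ratio F u\<close>.\<close>
lemma barrier_step:
  fixes F :: "complex ^ 'n ^ 'n \<Rightarrow> complex"
  assumes F: "stable_form F" and W: "finite W" and p: "\<And>w. w \<in> W \<Longrightarrow> 0 \<le> p w" "sum p W = 1"
    and X: "above_roots F X" and \<delta>: "0 < \<delta>" "1 / \<delta> \<le> (\<Sum>w\<in>W. p w * ratio F w X)"
    and A: "A = (\<Sum>w\<in>W. p w *\<^sub>R outer_self w)"
    and G: "G = (\<lambda>X. \<Sum>w\<in>W. of_real (p w) * F (X - outer_self w))"
  shows "above_roots G (X + \<delta> *\<^sub>R A)" and "ratio F u X \<le> ratio G u (X + \<delta> *\<^sub>R A)"
proof -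
  have psdA: "psd A" unfolding A by (intro psd_sum psd_scaleR p psd_outer_self)
  have \<delta>0: "0 \<le> \<delta>" using \<delta> by simp
  \<comment> \<open>The quotient G / F at X + P is the weighted mean of the ratios, which only grow
    with P, so it stays at least 1 / \<delta>.\<close>
  have G_ge: "Re (F (X + P)) / \<delta> \<le> Re (G (X + P))" if P: "psd P" for P
  proof -
    have FP: "0 < Re (F (X + P))" using above_pos[OF above_add[OF X P]] .
    have "1 / \<delta> \<le> (\<Sum>w\<in>W. p w * ratio F w X)" by (rule \<delta>)
    also have "\<dots> \<le> (\<Sum>w\<in>W. p w * ratio F w (X + P))"
      using ratio_psd_mono_concave(1)[OF F X P, of 1 0] by (intro sum_mono mult_left_mono p) auto
    also have "\<dots> = Re (G (X + P)) / Re (F (X + P))"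
      by (simp add: G ratio_def sum_divide_distrib)
    finally show ?thesis using FP by (simp add: field_simps)
  qed
  have G_pos: "0 < Re (G (X + P))" if P: "psd P" for P
    using G_ge[OF P] above_pos[OF above_add[OF X P]] \<delta> by (smt (verit) divide_pos_pos)
  define Y where "Y = X + \<delta> *\<^sub>R A"
  have psdd: "psd (\<delta> *\<^sub>R A)" using \<delta>0 psdA by (rule psd_scaleR)
  show "above_roots G (X + \<delta> *\<^sub>R A)"
    unfolding above_roots_def
  proof (intro conjI allI impI)
    show "adj (X + \<delta> *\<^sub>R A) = X + \<delta> *\<^sub>R A"
      using above_add[OF X psdd] by (simp add: above_roots_def)
    show "0 < Re (G (X + \<delta> *\<^sub>R A + P))" if "psd P" for P
      using G_pos[OF psd_add[OF psdd that]] by (simp add: add.assoc)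
  qed
  define a where "a = Re (F Y)"
  define b where "b = Re (F (Y - outer_self u))"
  define Ga where "Ga = Re (G Y)"
  define Gb where "Gb = Re (G (Y - outer_self u))"
  \<comment> \<open>The quotient-rule derivative at \<delta> of the function \<open>R\<close> below,
    since \<open>F\<close> has derivatives \<open>a - Ga\<close> and \<open>b - Gb\<close> on the
    two lines.\<close>
  define D where "D = ((b - Gb) * a - b * (a - Ga)) / (a * a)"
  have a: "0 < a" unfolding a_def Y_def by (rule above_pos[OF above_add[OF X psdd]])
  have Ga: "a / \<delta> \<le> Ga" "0 < Ga" unfolding a_def Ga_def Y_def by (rule G_ge[OF psdd], rule G_pos[OF psdd])
  define R where "R = (\<lambda>t. ratio F u (X + t *\<^sub>R A))"
  have dF: "((\<lambda>t. Re (F (X + t *\<^sub>R A))) has_real_derivative a - Ga) (at \<delta>)"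
    using stable_form_has_real_derivative[OF F W p(2) A] by (simp add: a_def Ga_def G Y_def)
  have dG: "((\<lambda>t. Re (F (X - outer_self u + t *\<^sub>R A))) has_real_derivative b - Gb) (at \<delta>)"
    using stable_form_has_real_derivative[OF F W p(2) A, of "X - outer_self u" \<delta>]
    by (simp add: b_def Gb_def G Y_def algebra_simps)
  have "(R has_real_derivative D) (at \<delta>)"
  proof -
    have "((\<lambda>t. Re (F (X - outer_self u + t *\<^sub>R A)) / Re (F (X + t *\<^sub>R A))) has_real_derivative
        ((b - Gb) * Re (F (X + \<delta> *\<^sub>R A)) - Re (F (X - outer_self u + \<delta> *\<^sub>R A)) * (a - Ga)) /
        (Re (F (X + \<delta> *\<^sub>R A)) * Re (F (X + \<delta> *\<^sub>R A)))) (at \<delta>)"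
      by (rule DERIV_divide[OF dG dF]) (use a in \<open>simp add: a_def Y_def\<close>)
    then show ?thesis
      by (simp add: R_def ratio_def D_def a_def b_def Y_def algebra_simps)
  qed
  then have "((\<lambda>\<tau>. (R (\<delta> + \<tau>) - R \<delta>) / \<tau>) \<longlongrightarrow> D) (at 0)"
    by (simp add: DERIV_def)
  then have lim: "((\<lambda>\<tau>. (R (\<delta> + \<tau>) - R \<delta>) / \<tau>) \<longlongrightarrow> D) (at_right 0)"
    by (rule filterlim_mono) (simp_all add: at_le)
  have mono: "R \<delta> \<le> R (\<delta> + \<tau>)" if "0 < \<tau>" for \<tau>
    using ratio_psd_mono_concave(1)[OF F above_add[OF X psdd] psdA, of \<tau> 0 u] that
    by (simp add: R_def algebra_simps)
  have conc: "\<delta> * (R (\<delta> + \<tau>) - R \<delta>) \<le> \<tau> * (R \<delta> - R 0)" if "0 < \<tau>" for \<tau>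
    using ratio_psd_mono_concave(2)[OF F X psdA \<delta>0, of \<tau> u] that by (simp add: R_def)
  have "0 \<le> D"
    by (rule tendsto_lowerbound[OF lim])
      (use mono in \<open>auto simp: eventually_at_filter intro!: always_eventually\<close>)
  \<comment> \<open>By concavity the slope at \<delta> is at most that of the chord from 0.\<close>
  have "D \<le> (R \<delta> - R 0) / \<delta>"
    by (rule tendsto_upperbound[OF lim])
      (use conc \<delta> in \<open>auto simp: eventually_at_filter field_simps intro!: always_eventually\<close>)
  then have "R 0 \<le> R \<delta> - \<delta> * D" using \<delta> by (simp add: field_simps)
  also have "\<dots> \<le> R \<delta> - a / Ga * D"
  proof -
    have "a / Ga \<le> \<delta>" using Ga \<delta> by (simp add: field_simps)
    from mult_right_mono[OF this \<open>0 \<le> D\<close>] show ?thesis by simp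
  qed
  also have "R \<delta> = b / a" by (simp add: R_def ratio_def a_def b_def Y_def)
  \<comment> \<open>By the formula for \<open>D\<close>, this subtraction is exactly the passage
    from the ratio of \<open>F\<close> to that of \<open>G\<close> at \<open>Y\<close>.\<close>
  also have "b / a - a / Ga * D = Gb / Ga"
    using a Ga(2) by (simp add: D_def field_simps)
  finally show "ratio F u X \<le> ratio G u (X + \<delta> *\<^sub>R A)"
    by (simp add: R_def ratio_def Ga_def Gb_def Y_def)
qed

section \<open>Positivity of the determinant and the initial barrier\<close>

lemma stable_form_pos:
  fixes F :: "complex ^ 'n ^ 'n \<Rightarrow> complex"
  assumes F: "stable_form F" and nz: "\<And>t. 0 \<le> t \<Longrightarrow> Re (F (X + t *\<^sub>R mat 1)) \<noteq> 0"
  shows "0 < Re (F X)"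
proof (rule ccontr)
  assume neg: "\<not> 0 < Re (F X)"
  obtain T where T: "\<And>t. t \<ge> T \<Longrightarrow> 0 < Re (F (X + t *\<^sub>R mat 1))"
    using stable_form_eventually_pos[OF F] by blast
  have "\<exists>t\<ge>0. t \<le> max 0 T \<and> Re (F (X + t *\<^sub>R mat 1)) = 0"
    by (rule IVT'[OF _ _ _ continuous_on_stable_form_line[OF F]]) (use neg T[of "max 0 T"] in auto)
  with nz show False by blast
qed

text \<open>The determinant does not vanish on the ray from \<open>A\<close> in direction
  \<open>mat 1\<close>, and it is positive far out.\<close>

lemma det_pos_if_pd:
  assumes "pd A" shows "0 < Re (det A)"
proof (rule stable_form_pos[OF stable_form_det])
  fix t :: real assume "0 \<le> t"
  then have pd: "pd (A + t *\<^sub>R mat 1)" by (intro pd_add_psd assms psd_scaleR psd_mat_1)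
  then have "det (A + t *\<^sub>R mat 1) = of_real (Re (det (A + t *\<^sub>R mat 1)))"
    by (intro stable_form_real[OF stable_form_det]) (simp add: pd_def)
  then show "Re (det (A + t *\<^sub>R mat 1)) \<noteq> 0" using det_nonzero_if_pd[OF pd] by auto
qed

lemma above_det_scaled_id: "0 < t \<Longrightarrow> above_roots det (t *\<^sub>R mat 1)"
  unfolding above_roots_def by (auto simp: adj_scaleR intro!: det_pos_if_pd pd_add_psd pd_scaleR)

lemma ratio_det_scaled_id:
  fixes u :: "complex ^ 'n"
  assumes t: "0 < t" shows "ratio det u (t *\<^sub>R mat 1) = 1 - (norm u)\<^sup>2 / t"
proof -
  have pos: "0 < Re (det (t *\<^sub>R mat 1 :: complex ^ 'n ^ 'n))"
    by (rule above_pos[OF above_det_scaled_id[OF t]])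
  show ?thesis
  proof (cases "u = 0")
    case True
    then have "outer_self u = 0" by (simp add: outer_self_def vec_eq_iff)
    then show ?thesis using True pos by (simp add: ratio_def)
  next
    case False
    define D where "D = det (t *\<^sub>R mat 1 :: complex ^ 'n ^ 'n)"
    \<comment> \<open>At this \<open>z\<close> the vector \<open>u\<close> lies in the kernel, so
      \<open>det_outer_self\<close> becomes a linear equation for
      \<open>det (t *\<^sub>R mat 1 - outer_self u)\<close>.\<close>
    define z :: complex where "z = - of_real (t / (norm u)\<^sup>2)"
    have uu: "outer_self u *v u = of_real ((norm u)\<^sup>2) *s u"
    proof -
      have "(\<Sum>j\<in>UNIV. cnj (u $ j) * u $ j) = of_real ((norm u)\<^sup>2)"
        using hform_mat_1[of u] unfolding hform_mult_vec by simp
      then have "(\<Sum>j\<in>UNIV. u $ i * (cnj (u $ j) * u $ j)) = of_real ((norm u)\<^sup>2) * u $ i" for i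
        by (simp add: mult.commute flip: sum_distrib_left)
      then show ?thesis by (simp add: vec_eq_iff matrix_vector_mult_def outer_self_def mult_ac)
    qed
    have cs: "cscale c B *v x = c *s (B *v x)" for c and B :: "complex ^ 'n ^ 'n" and x
      by (simp add: vec_eq_iff cscale_def matrix_vector_mult_def sum_distrib_left mult_ac)
    have "(t *\<^sub>R mat 1 + cscale z (outer_self u)) *v u = 0"
      using False unfolding matrix_vector_mult_add_rdistrib cscale_of_real[symmetric] cs uu
      by (simp add: z_def vec_eq_iff)
    then have "det (t *\<^sub>R mat 1 + cscale z (outer_self u)) = 0"
      using False matrix_left_invertible_ker invertible_left_inverse invertible_det_nz by blast
    then have "D + z * (D - det (t *\<^sub>R mat 1 - outer_self u)) = 0"
      unfolding det_outer_self D_def .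
    then have "det (t *\<^sub>R mat 1 - outer_self u) = of_real (1 - (norm u)\<^sup>2 / t) * D"
      using t False by (simp add: z_def field_simps)
    then have "Re (det (t *\<^sub>R mat 1 - outer_self u)) = (1 - (norm u)\<^sup>2 / t) * Re D" by simp
    then show ?thesis using pos
      by (simp add: ratio_def D_def)
  qed
qed

section \<open>From determinants to the operator norm\<close>

definition sesq :: "complex ^ 'n ^ 'n \<Rightarrow> complex ^ 'n \<Rightarrow> complex ^ 'n \<Rightarrow> complex" where
  "sesq B x y = (\<Sum>i\<in>UNIV. \<Sum>j\<in>UNIV. cnj (x $ i) * B $ i $ j * y $ j)"

lemma hform_sesq: "hform B x = sesq B x x"
  by (simp add: hform_def sesq_def)

lemma sesq_mult_vec: "sesq B x y = (\<Sum>i\<in>UNIV. cnj (x $ i) * (B *v y) $ i)"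
  by (simp add: sesq_def matrix_vector_mult_def sum_distrib_left mult_ac)

lemma sesq_mult_vec_self: "sesq B (B *v y) y = of_real ((norm (B *v y))\<^sup>2)"
  using hform_mat_1[of "B *v y"] by (simp add: sesq_mult_vec hform_mult_vec)

lemma sesq_adj: "adj B = B \<Longrightarrow> sesq B y x = cnj (sesq B x y)"
proof -
  assume "adj B = B"
  then have "cnj (B $ i $ j) = B $ j $ i" for i j
    unfolding adj_def vec_eq_iff by simp
  then show ?thesis
    unfolding sesq_def cnj_sum by (subst sum.swap) (simp add: mult_ac)
qed

lemma psd_Cauchy_Schwarz:
  assumes B: "psd B"
  shows "(cmod (sesq B x y))\<^sup>2 \<le> Re (hform B x) * Re (hform B y)"
proof -
  define q where "q = sesq B x y"
  define a where "a = Re (hform B x)"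
  define b where "b = Re (hform B y)"
  have b: "0 \<le> b" using B by (simp add: psd_def b_def)
  have adjB: "adj B = B" using B by (simp add: psd_def)
  have ge: "2 * s * (cmod q)\<^sup>2 \<le> a + s\<^sup>2 * (cmod q)\<^sup>2 * b" for s :: real
  proof -
    \<comment> \<open>The factor \<open>cnj q\<close> makes both cross terms real and equal to -s
      |q|^2.\<close>
    define z where "z = - of_real s * cnj q"
    have "hform B (x + z *s y) = sesq B x x + z * sesq B x y + cnj z * sesq B y x + cnj z * z * sesq B y y"
      unfolding hform_def sesq_def
      by (simp add: algebra_simps sum.distrib sum_distrib_left)
    also have "\<dots> = hform B x - of_real s * (cnj q * q) - of_real s * (q * cnj q) + of_real (s\<^sup>2) * (q * cnj q) * hform B y"
      unfolding sesq_adj[OF adjB, of y x] hform_sesq[symmetric] q_def[symmetric]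
      by (simp add: z_def power2_eq_square algebra_simps)
    also have "\<dots> = hform B x - of_real (2 * s * (cmod q)\<^sup>2) + of_real (s\<^sup>2 * (cmod q)\<^sup>2) * hform B y"
      using complex_norm_square[of q] by (simp add: mult_ac)
    finally have "Re (hform B (x + z *s y)) = a - 2 * s * (cmod q)\<^sup>2 + s\<^sup>2 * (cmod q)\<^sup>2 * b"
      by (simp add: a_def b_def del: of_real_mult of_real_power)
    moreover have "0 \<le> Re (hform B (x + z *s y))" using B by (simp add: psd_def)
    ultimately show ?thesis by simp
  qed
  have "(cmod q)\<^sup>2 \<le> a * b"
  proof (cases "b = 0")
    case True
    have "q = 0"
    proof (rule ccontr)
      assume "q \<noteq> 0"
      \<comment> \<open>With b = 0 this choice of s gives a + 1 \<le> a.\<close>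
      then show False
        using ge[of "(a + 1) / (2 * (cmod q)\<^sup>2)"] True by (simp add: field_simps)
    qed
    then show ?thesis using True by simp
  next
    case False
    \<comment> \<open>The value s = 1 / b minimizes the quadratic in s.\<close>
    then show ?thesis using ge[of "1 / b"] b by (simp add: field_simps power2_eq_square)
  qed
  then show ?thesis by (simp add: q_def a_def b_def)
qed

lemma hform_scale_vec: "hform B (of_real r *s x) = of_real (r\<^sup>2) * hform B x"
  by (simp add: hform_def sum_distrib_left power2_eq_square mult_ac)

lemma continuous_on_hform: "continuous_on S (\<lambda>x. Re (hform B x))"
  unfolding hform_def by (intro continuous_intros)

text \<open>A maximizer of the quadratic form of \<open>S\<close> on the sphere is an eigenvector.\<close>
lemma hform_le_if_det_nonzero:
  fixes S :: "complex ^ 'n ^ 'n"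
  assumes S: "adj S = S" and nz: "\<And>t. c \<le> t \<Longrightarrow> det (t *\<^sub>R mat 1 - S) \<noteq> 0"
  shows "Re (hform S x) \<le> c * (norm x)\<^sup>2"
proof -
  have "sphere (0 :: complex ^ 'n) 1 \<noteq> {}"
    using vector_choose_size[of 1, where 'a = "complex ^ 'n"] by auto
  from continuous_attains_sup[OF compact_sphere this continuous_on_hform, of S]
  obtain x0 where x0: "norm x0 = 1" "\<And>x. norm x = 1 \<Longrightarrow> Re (hform S x) \<le> Re (hform S x0)"
    by auto
  define l where "l = Re (hform S x0)"
  have le: "Re (hform S x) \<le> l * (norm x)\<^sup>2" for x
  proof (cases "x = 0")
    case False
    have x: "x = of_real (norm x) *s (of_real (inverse (norm x)) *s x)"
      using False by (simp add: vec_eq_iff)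
    have "norm (of_real (inverse (norm x)) *s x) = 1"
    proof -
      have "of_real (inverse (norm x)) *s x = inverse (norm x) *\<^sub>R x"
        by (simp add: vec_eq_iff scaleR_conv_of_real[where 'a = complex])
      then show ?thesis using False by simp
    qed
    then have "Re (hform S (of_real (inverse (norm x)) *s x)) \<le> l" unfolding l_def by (rule x0)
    then have "(norm x)\<^sup>2 * Re (hform S (of_real (inverse (norm x)) *s x)) \<le> (norm x)\<^sup>2 * l"
      by (rule mult_left_mono) simp
    also have "(norm x)\<^sup>2 * Re (hform S (of_real (inverse (norm x)) *s x)) = Re (hform S x)"
      by (subst (4) x, subst hform_scale_vec) simp
    finally show ?thesis by (simp add: mult.commute)
  qed (simp add: hform_def)
  define B where "B = l *\<^sub>R mat 1 - S"
  have hB: "Re (hform B x) = l * (norm x)\<^sup>2 - Re (hform S x)" for x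
    by (simp add: B_def hform_diff hform_scaleR hform_mat_1)
  have "psd B" unfolding psd_def using le S by (simp add: hB) (simp add: B_def adj_diff adj_scaleR)
  \<comment> \<open>The form of \<open>B\<close> vanishes at \<open>x0\<close>, so Cauchy-Schwarz
    forces \<open>B *v x0\<close> to be 0.\<close>
  from psd_Cauchy_Schwarz[OF this, of "B *v x0" x0]
  have "(cmod (sesq B (B *v x0) x0))\<^sup>2 \<le> 0" by (simp add: hB x0 l_def)
  then have "B *v x0 = 0" unfolding sesq_mult_vec_self by simp
  moreover have "x0 \<noteq> 0" using x0 by auto
  ultimately have "det B = 0"
    using matrix_left_invertible_ker invertible_left_inverse invertible_det_nz by blast
  then have "l < c" using nz[of l] by (force simp: B_def)
  then have "l * (norm x)\<^sup>2 \<le> c * (norm x)\<^sup>2" by (intro mult_right_mono) auto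
  with le[of x] show ?thesis by linarith
qed

text \<open>Adding multiples of \<open>mat 1\<close> shows that \<open>t *\<^sub>R mat 1 - S\<close>
  is nonsingular for t \<ge> c, which bounds the quadratic form. Cauchy-Schwarz for the form of
  \<open>S\<close> then gives n^4 \<le> c n^2 c |x|^2 for the norm n of
  \<open>S *v x\<close>.\<close>

lemma op_norm_le_if_above_det:
  fixes S :: "complex ^ 'n ^ 'n"
  assumes S: "psd S" and c: "0 \<le> c" and ab: "above_roots det (c *\<^sub>R mat 1 - S)"
  shows "op_norm S \<le> c"
  unfolding op_norm_def
proof (rule onorm_bound[OF c])
  have nz: "det (t *\<^sub>R mat 1 - S) \<noteq> 0" if "c \<le> t" for t
  proof -
    have "psd ((t - c) *\<^sub>R mat 1 :: complex ^ 'n ^ 'n)" using that by (intro psd_scaleR psd_mat_1) simp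
    from above_pos[OF above_add[OF ab this]] show ?thesis by (auto simp: algebra_simps)
  qed
  have le: "Re (hform S x) \<le> c * (norm x)\<^sup>2" for x
    using S by (intro hform_le_if_det_nonzero nz) (simp add: psd_def)
  fix x
  define n where "n = norm (S *v x)"
  have ge0: "0 \<le> Re (hform S x)" for x using S by (simp add: psd_def)
  have "(n\<^sup>2)\<^sup>2 \<le> Re (hform S (S *v x)) * Re (hform S x)"
    using psd_Cauchy_Schwarz[OF S, of "S *v x" x] unfolding sesq_mult_vec_self by (simp add: n_def del: of_real_power)
  also have "\<dots> \<le> (c * n\<^sup>2) * (c * (norm x)\<^sup>2)"
    unfolding n_def using c by (intro mult_mono le ge0) auto
  finally have *: "n\<^sup>2 * n\<^sup>2 \<le> n\<^sup>2 * (c * norm x)\<^sup>2" by (simp add: power2_eq_square mult_ac)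
  have "n\<^sup>2 \<le> (c * norm x)\<^sup>2"
  proof (cases "n = 0")
    case False
    then have "0 < n\<^sup>2" by simp
    from mult_le_cancel_left_pos[OF this] * show ?thesis by blast
  qed simp
  then show "norm (S *v x) \<le> c * norm x"
    unfolding n_def by (rule power2_le_imp_le) (simp add: c)
qed

section \<open>Mixed characteristic polynomials\<close>

text \<open>Encodes a finitely supported law as a set carrying it together with its point
  masses.\<close>

type_synonym 'n weighted_vectors = "(complex ^ 'n) set \<times> (complex ^ 'n \<Rightarrow> real)"

definition weighted :: "'n::finite weighted_vectors \<Rightarrow> bool" where
  "weighted a \<longleftrightarrow> finite (fst a) \<and> (\<forall>w\<in>fst a. 0 \<le> snd a w) \<and> sum (snd a) (fst a) = 1"

definition second_moment :: "'n::finite weighted_vectors \<Rightarrow> complex ^ 'n ^ 'n" where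
  "second_moment a = (\<Sum>w\<in>fst a. snd a w *\<^sub>R outer_self w)"

definition average :: "'n::finite weighted_vectors \<Rightarrow> (complex ^ 'n ^ 'n \<Rightarrow> complex) \<Rightarrow> complex ^ 'n ^ 'n \<Rightarrow> complex" where
  "average a F X = (\<Sum>w\<in>fst a. of_real (snd a w) * F (X - outer_self w))"

text \<open>At \<open>X = x I\<close> this is the mixed characteristic polynomial of the second moments.\<close>
definition mixed_det :: "'n::finite weighted_vectors list \<Rightarrow> complex ^ 'n ^ 'n \<Rightarrow> complex" where
  "mixed_det L = foldr average L det"

lemma stable_form_mixed_det:
  "(\<And>a. a \<in> set L \<Longrightarrow> weighted a) \<Longrightarrow> stable_form (mixed_det L)"
proof (induction L)
  case (Cons a L)
  then have "stable_form (mixed_det L)" "weighted a" by auto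
  then show ?case
    using stable_form_average[of "mixed_det L" "fst a" "snd a"]
    by (simp add: mixed_det_def weighted_def average_def[abs_def])
qed (simp add: mixed_det_def stable_form_det)

text \<open>Starting from \<open>t *\<^sub>R mat 1\<close>, each vector costs a shift by \<delta>
  times its second moment and does not lower the bound on \<open>ratio\<close>. That bound averages
  to at least 1 - \<epsilon> / t \<ge> 1 / \<delta>, the hypothesis of
  \<open>barrier_step\<close>.\<close>

lemma mixed_det_above:
  fixes L :: "'n::finite weighted_vectors list"
  assumes L: "\<And>a. a \<in> set L \<Longrightarrow> weighted a \<and> (\<Sum>w\<in>fst a. snd a w * (norm w)\<^sup>2) \<le> \<epsilon>"
    and t: "0 < t" and \<delta>: "0 < \<delta>" "1 / \<delta> \<le> 1 - \<epsilon> / t"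
  defines "X \<equiv> \<lambda>L. t *\<^sub>R mat 1 + \<delta> *\<^sub>R sum_list (map second_moment L) :: complex ^ 'n ^ 'n"
  shows "above_roots (mixed_det L) (X L) \<and> (\<forall>u. 1 - (norm u)\<^sup>2 / t \<le> ratio (mixed_det L) u (X L))"
  using L
proof (induction L)
  case Nil
  then show ?case
    by (simp add: mixed_det_def X_def above_det_scaled_id ratio_det_scaled_id t)
next
  case (Cons a L)
  have IH: "above_roots (mixed_det L) (X L)" "\<And>u. 1 - (norm u)\<^sup>2 / t \<le> ratio (mixed_det L) u (X L)"
    using Cons by auto
  have st: "stable_form (mixed_det L)" using Cons.prems by (intro stable_form_mixed_det) auto
  have a: "finite (fst a)" "\<And>w. w \<in> fst a \<Longrightarrow> 0 \<le> snd a w" "sum (snd a) (fst a) = 1"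
    "(\<Sum>w\<in>fst a. snd a w * (norm w)\<^sup>2) \<le> \<epsilon>"
    using Cons.prems[of a] by (auto simp: weighted_def)
  have "1 / \<delta> \<le> 1 - \<epsilon> / t" by (rule \<delta>)
  also have "\<dots> \<le> 1 - (\<Sum>w\<in>fst a. snd a w * (norm w)\<^sup>2) / t"
    using a(4) t by (simp add: divide_right_mono)
  also have "\<dots> = (\<Sum>w\<in>fst a. snd a w * (1 - (norm w)\<^sup>2 / t))"
    using a(3) by (simp add: right_diff_distrib sum_subtractf sum_divide_distrib)
  also have "\<dots> \<le> (\<Sum>w\<in>fst a. snd a w * ratio (mixed_det L) w (X L))"
    by (intro sum_mono mult_left_mono IH a)
  finally have barrier: "1 / \<delta> \<le> (\<Sum>w\<in>fst a. snd a w * ratio (mixed_det L) w (X L))" .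
  have G: "mixed_det (a # L) = (\<lambda>X. \<Sum>w\<in>fst a. of_real (snd a w) * mixed_det L (X - outer_self w))"
    by (simp add: mixed_det_def average_def[abs_def])
  have X: "X (a # L) = X L + \<delta> *\<^sub>R second_moment a"
    by (simp add: X_def algebra_simps)
  note step = barrier_step[OF st a(1,2,3) IH(1) \<delta>(1) barrier second_moment_def G, folded X]
  show ?case
    using step(1) order_trans[OF IH(2) step(2)] by blast
qed

text \<open>The vectors are fixed one at a time: \<open>above_average_obtain\<close> removes one
  average and moves the chosen rank-one matrix into X.\<close>

lemma mixed_det_above_obtain:
  fixes L :: "'n::finite weighted_vectors list"
  assumes "\<And>a. a \<in> set L \<Longrightarrow> weighted a" and "above_roots (mixed_det L) X"
  shows "\<exists>ws. list_all2 (\<lambda>w a. w \<in> fst a \<and> 0 < snd a w) ws L \<and>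
    above_roots det (X - sum_list (map outer_self ws))"
  using assms
proof (induction L arbitrary: X)
  case Nil
  then show ?case by (simp add: mixed_det_def)
next
  case (Cons a L)
  have st: "stable_form (mixed_det L)" using Cons.prems by (intro stable_form_mixed_det) auto
  have a: "finite (fst a)" "\<And>w. w \<in> fst a \<Longrightarrow> 0 \<le> snd a w" "sum (snd a) (fst a) = 1"
    using Cons.prems(1)[of a] by (auto simp: weighted_def)
  have "above_roots (\<lambda>X. \<Sum>w\<in>fst a. of_real (snd a w) * mixed_det L (X - outer_self w)) X"
    using Cons.prems(2) by (simp add: mixed_det_def average_def[abs_def])
  from above_average_obtain[OF st a this]
  obtain w where w: "w \<in> fst a" "0 < snd a w" "above_roots (mixed_det L) (X - outer_self w)" by blast
  from Cons.IH[OF _ w(3)] Cons.prems(1)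
  obtain ws where "list_all2 (\<lambda>w a. w \<in> fst a \<and> 0 < snd a w) ws L"
    "above_roots det (X - outer_self w - sum_list (map outer_self ws))" by auto
  with w show ?case by (intro exI[of _ "w # ws"]) (simp add: diff_diff_eq)
qed

lemma exists_choice_op_norm_le:
  fixes L :: "'n::finite weighted_vectors list"
  assumes \<epsilon>: "0 < \<epsilon>"
    and L: "\<And>a. a \<in> set L \<Longrightarrow> weighted a \<and> (\<Sum>w\<in>fst a. snd a w * (norm w)\<^sup>2) \<le> \<epsilon>"
    and id: "sum_list (map second_moment L) = mat 1"
  shows "\<exists>ws. list_all2 (\<lambda>w a. w \<in> fst a \<and> 0 < snd a w) ws L \<and>
    op_norm (sum_list (map outer_self ws)) \<le> (1 + sqrt \<epsilon>)\<^sup>2"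
proof -
  \<comment> \<open>These values minimize t + \<delta> subject to 1 / \<delta> \<le> 1 - \<epsilon>
    / t: the constraint is tight and the sum is (1 + sqrt \<epsilon>)^2.\<close>
  define t where "t = \<epsilon> + sqrt \<epsilon>"
  define \<delta> where "\<delta> = 1 + sqrt \<epsilon>"
  have s: "0 < sqrt \<epsilon>" "sqrt \<epsilon> * sqrt \<epsilon> = \<epsilon>" using \<epsilon> by auto
  have t: "0 < t" and \<delta>: "0 < \<delta>" using \<epsilon> s by (auto simp: t_def \<delta>_def intro: add_pos_pos)
  have "t = sqrt \<epsilon> * \<delta>" using s by (simp add: t_def \<delta>_def algebra_simps)
  then have "\<epsilon> / t = sqrt \<epsilon> / \<delta>" using s \<delta> by (simp add: field_simps)
  then have bar: "1 / \<delta> \<le> 1 - \<epsilon> / t" using \<delta> by (simp add: \<delta>_def field_simps)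
  have "t + \<delta> = (1 + sqrt \<epsilon>)\<^sup>2" using s by (simp add: t_def \<delta>_def power2_eq_square algebra_simps)
  then have "t *\<^sub>R mat 1 + \<delta> *\<^sub>R sum_list (map second_moment L) = (1 + sqrt \<epsilon>)\<^sup>2 *\<^sub>R mat 1"
    unfolding id by (simp flip: scaleR_add_left)
  with mixed_det_above[of L \<epsilon> t \<delta>, OF L t \<delta> bar] have "above_roots (mixed_det L) ((1 + sqrt \<epsilon>)\<^sup>2 *\<^sub>R mat 1)"
    by simp
  from mixed_det_above_obtain[OF _ this] L
  obtain ws where ws: "list_all2 (\<lambda>w a. w \<in> fst a \<and> 0 < snd a w) ws L"
    "above_roots det ((1 + sqrt \<epsilon>)\<^sup>2 *\<^sub>R mat 1 - sum_list (map outer_self ws))" by blast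
  have "psd (sum_list (map outer_self ws))" by (induction ws) (auto simp: psd_add)
  from op_norm_le_if_above_det[OF this _ ws(2)] ws(1) show ?thesis by auto
qed

section \<open>Independent random vectors\<close>

text \<open>On \<open>space M\<close> the integrand is a finite combination of indicators of the
  level sets of \<open>X\<close>, whatever \<open>g\<close> is.\<close>

lemma integral_finite_support:
  fixes X :: "'w \<Rightarrow> 'b::{second_countable_topology, t1_space}"
    and g :: "'b \<Rightarrow> 'c::{banach, second_countable_topology}"
  assumes M: "prob_space M" and X: "X \<in> borel_measurable M" and fin: "has_finite_support M X"
  shows "(\<integral>\<omega>. g (X \<omega>) \<partial>M) = (\<Sum>w\<in>X ` space M. measure M (X -` {w} \<inter> space M) *\<^sub>R g w)"
proof -
  interpret prob_space M by (rule M)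
  have fin': "finite (X ` space M)" using fin by (simp add: has_finite_support_def)
  have sets: "X -` {w} \<inter> space M \<in> sets M" for w
    using X by (rule measurable_sets) simp
  have "(\<integral>\<omega>. g (X \<omega>) \<partial>M) = (\<integral>\<omega>. (\<Sum>w\<in>X ` space M. indicator (X -` {w} \<inter> space M) \<omega> *\<^sub>R g w) \<partial>M)"
  proof (rule Bochner_Integration.integral_cong[OF refl])
    fix \<omega> assume \<omega>: "\<omega> \<in> space M"
    have "(\<Sum>w\<in>X ` space M. indicator (X -` {w} \<inter> space M) \<omega> *\<^sub>R g w) =
        (\<Sum>w\<in>X ` space M. if w = X \<omega> then g w else 0)"
      using \<omega> by (intro sum.cong) (auto simp: indicator_def)
    also have "\<dots> = g (X \<omega>)" using \<omega> fin' by simp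
    finally show "g (X \<omega>) = (\<Sum>w\<in>X ` space M. indicator (X -` {w} \<inter> space M) \<omega> *\<^sub>R g w)" ..
  qed
  also have "\<dots> = (\<Sum>w\<in>X ` space M. \<integral>\<omega>. indicator (X -` {w} \<inter> space M) \<omega> *\<^sub>R g w \<partial>M)"
    by (intro Bochner_Integration.integral_sum integrable_scaleR_left) (simp add: sets emeasure_eq_measure)
  also have "\<dots> = (\<Sum>w\<in>X ` space M. measure M (X -` {w} \<inter> space M) *\<^sub>R g w)"
    by (intro sum.cong refl, subst integral_scaleR_left) (auto simp: sets emeasure_eq_measure)
  finally show ?thesis .
qed

theorem theorem3p2:
  fixes M :: "'w measure"
    and v :: "nat \<Rightarrow> 'w \<Rightarrow> complex ^ 'd"
    and m :: nat
    and \<epsilon> :: real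
  assumes "\<epsilon> > 0"
    and "prob_space M"
    and "prob_space.indep_vars M (\<lambda>_. borel) v {1..m}"
    and "\<And>i. i \<in> {1..m} \<Longrightarrow> has_finite_support M (v i)"
    and "(\<Sum>i=1..m. \<integral>\<omega>. outer_self (v i \<omega>) \<partial>M) = mat 1"
    and "\<And>i. i \<in> {1..m} \<Longrightarrow> (\<integral>\<omega>. (norm (v i \<omega>))\<^sup>2 \<partial>M) \<le> \<epsilon>"
  shows "measure M {\<omega> \<in> space M. op_norm (\<Sum>i=1..m. outer_self (v i \<omega>)) \<le> (1 + sqrt \<epsilon>)\<^sup>2} > 0"
proof -
  interpret prob_space M by (rule assms(2))
  have meas: "v i \<in> borel_measurable M" if "i \<in> {1..m}" for i
    using assms(3) that unfolding indep_vars_def by auto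
  define event where "event = (\<lambda>i w. v i -` {w} \<inter> space M)"
  have event_sets: "event i w \<in> sets M" if "i \<in> {1..m}" for i w
    unfolding event_def using meas[OF that] by (rule measurable_sets) simp
  \<comment> \<open>The law of \<open>v i\<close>: its range with the probabilities of its level
    sets.\<close>
  define a where "a = (\<lambda>i. (v i ` space M, \<lambda>w. prob (event i w)))"
  define L where "L = map a [1..<Suc m]"
  have expectation: "(\<integral>\<omega>. g (v i \<omega>) \<partial>M) = (\<Sum>w\<in>fst (a i). snd (a i) w *\<^sub>R g w)"
    if "i \<in> {1..m}" for i and g :: "complex ^ 'd \<Rightarrow> 'c::{banach, second_countable_topology}"
    using integral_finite_support[OF assms(2) meas[OF that] assms(4)[OF that], of g]
    by (simp add: a_def event_def)
  have "weighted (a i) \<and> (\<Sum>w\<in>fst (a i). snd (a i) w * (norm w)\<^sup>2) \<le> \<epsilon>" if i: "i \<in> {1..m}" for i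
  proof
    have "sum (snd (a i)) (fst (a i)) = 1"
      using expectation[OF i, of "\<lambda>_. 1 :: real"] by (simp add: prob_space)
    then show "weighted (a i)"
      using assms(4)[OF i] by (simp add: weighted_def has_finite_support_def a_def)
    show "(\<Sum>w\<in>fst (a i). snd (a i) w * (norm w)\<^sup>2) \<le> \<epsilon>"
      using expectation[OF i, of "\<lambda>w. (norm w)\<^sup>2"] assms(6)[OF i] by simp
  qed
  then have L: "weighted b \<and> (\<Sum>w\<in>fst b. snd b w * (norm w)\<^sup>2) \<le> \<epsilon>" if "b \<in> set L" for b
    using that unfolding L_def by auto
  have sum_upt: "sum_list (map f [1..<Suc m]) = (\<Sum>i=1..m. f i)" for f :: "nat \<Rightarrow> complex ^ 'd ^ 'd"
    by (simp add: sum_list_distinct_conv_sum_set atLeastLessThanSuc_atLeastAtMost del: upt_Suc)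
  have "sum_list (map second_moment L) = (\<Sum>i=1..m. second_moment (a i))"
    unfolding L_def map_map o_def by (rule sum_upt)
  also have "\<dots> = mat 1"
    unfolding assms(5)[symmetric] second_moment_def by (intro sum.cong refl) (simp add: expectation)
  finally obtain ws where ws: "list_all2 (\<lambda>w b. w \<in> fst b \<and> 0 < snd b w) ws L"
    and norm_le: "op_norm (sum_list (map outer_self ws)) \<le> (1 + sqrt \<epsilon>)\<^sup>2"
    using exists_choice_op_norm_le[OF assms(1) L] by blast
  \<comment> \<open>Positions in \<open>ws\<close> count from 0, the vectors from 1.\<close>
  define w where "w = (\<lambda>i. ws ! (i - 1))"
  have len: "length ws = m" using ws by (simp add: list_all2_lengthD L_def)
  have ws_eq: "ws = map w [1..<Suc m]"
    by (rule nth_equalityI) (simp_all add: len w_def del: upt_Suc)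
  have pos: "0 < prob (event i (w i))" if i: "i \<in> {1..m}" for i
  proof -
    have "i - 1 < length ws" using i len by auto
    moreover have "L ! (i - 1) = a i" using i by (cases i) (simp_all add: L_def del: upt_Suc)
    ultimately show ?thesis
      using list_all2_nthD[OF ws, of "i - 1"] by (simp add: a_def w_def)
  qed
  \<comment> \<open>For m = 0 the sum would be 0 rather than \<open>mat 1\<close>. This matters
    below, where an empty intersection would be \<open>UNIV\<close> and not
    \<open>space M\<close>.\<close>
  have m: "m \<noteq> 0"
  proof
    assume "m = 0"
    then have "(mat 1 :: complex ^ 'd ^ 'd) = 0" using assms(5) by simp
    then have "(mat 1 :: complex ^ 'd ^ 'd) $ undefined $ undefined = 0" by simp
    then show False by (simp add: mat_def)
  qed
  have "prob (\<Inter>i\<in>{1..m}. event i (w i)) = (\<Prod>i\<in>{1..m}. prob (event i (w i)))"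
    using assms(3) m unfolding indep_vars_def2
    by (intro indep_setsD) (auto simp: event_def)
  also have "\<dots> > 0" by (intro prod_pos) (use pos in auto)
  finally have "0 < prob (\<Inter>i\<in>{1..m}. event i (w i))" .
  also have "\<dots> \<le> prob {\<omega> \<in> space M. op_norm (\<Sum>i=1..m. outer_self (v i \<omega>)) \<le> (1 + sqrt \<epsilon>)\<^sup>2}"
  proof (rule finite_measure_mono)
    show "(\<Inter>i\<in>{1..m}. event i (w i)) \<subseteq> {\<omega> \<in> space M. op_norm (\<Sum>i=1..m. outer_self (v i \<omega>)) \<le> (1 + sqrt \<epsilon>)\<^sup>2}"
    proof
      fix \<omega> assume "\<omega> \<in> (\<Inter>i\<in>{1..m}. event i (w i))"
      then have "\<omega> \<in> space M" "\<And>i. i \<in> {1..m} \<Longrightarrow> v i \<omega> = w i" using m by (auto simp: event_def)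
      moreover from this have "(\<Sum>i=1..m. outer_self (v i \<omega>)) = sum_list (map outer_self ws)"
        unfolding ws_eq map_map o_def sum_upt by (intro sum.cong) auto
      ultimately show "\<omega> \<in> {\<omega> \<in> space M. op_norm (\<Sum>i=1..m. outer_self (v i \<omega>)) \<le> (1 + sqrt \<epsilon>)\<^sup>2}"
        using norm_le by simp
    qed
    \<comment> \<open>Monotonicity of the measure needs the larger event to be measurable: it is the
      union of the joint level sets over the tuples in \<open>U\<close>. Taking extensional
      functions keeps the set of tuples finite.\<close>
    define U where "U = {x \<in> (\<Pi>\<^sub>E i\<in>{1..m}. v i ` space M). op_norm (\<Sum>i=1..m. outer_self (x i)) \<le> (1 + sqrt \<epsilon>)\<^sup>2}"
    have "finite U"
      unfolding U_def using assms(4)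
      by (intro finite_subset[OF Collect_restrict] finite_PiE) (auto simp: has_finite_support_def)
    moreover have "{\<omega> \<in> space M. op_norm (\<Sum>i=1..m. outer_self (v i \<omega>)) \<le> (1 + sqrt \<epsilon>)\<^sup>2} =
        (\<Union>x\<in>U. \<Inter>i\<in>{1..m}. event i (x i))"
    proof (intro equalityI subsetI)
      fix \<omega> assume \<omega>: "\<omega> \<in> {\<omega> \<in> space M. op_norm (\<Sum>i=1..m. outer_self (v i \<omega>)) \<le> (1 + sqrt \<epsilon>)\<^sup>2}"
      then have "restrict (\<lambda>i. v i \<omega>) {1..m} \<in> U" unfolding U_def by auto
      then show "\<omega> \<in> (\<Union>x\<in>U. \<Inter>i\<in>{1..m}. event i (x i))"
        using \<omega> by (intro UN_I) (auto simp: event_def)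
    next
      fix \<omega> assume "\<omega> \<in> (\<Union>x\<in>U. \<Inter>i\<in>{1..m}. event i (x i))"
      then obtain x where x: "x \<in> U" "\<omega> \<in> (\<Inter>i\<in>{1..m}. event i (x i))" by blast
      then have "\<omega> \<in> space M" "\<And>i. i \<in> {1..m} \<Longrightarrow> v i \<omega> = x i" using m by (auto simp: event_def)
      moreover from this have "(\<Sum>i=1..m. outer_self (v i \<omega>)) = (\<Sum>i=1..m. outer_self (x i))"
        by (intro sum.cong) auto
      ultimately show "\<omega> \<in> {\<omega> \<in> space M. op_norm (\<Sum>i=1..m. outer_self (v i \<omega>)) \<le> (1 + sqrt \<epsilon>)\<^sup>2}"
        using x(1) by (simp add: U_def)
    qed
    moreover have "(\<Inter>i\<in>{1..m}. event i (x i)) \<in> sets M" for x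
      using m event_sets by (intro sets.finite_INT) auto
    ultimately show "{\<omega> \<in> space M. op_norm (\<Sum>i=1..m. outer_self (v i \<omega>)) \<le> (1 + sqrt \<epsilon>)\<^sup>2} \<in> sets M"
      by (simp add: sets.finite_UN)
  qed
  finally show ?thesis .
qed

end
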